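(* Let $K\geq 1$, let $f\in\mathcal{S}_H^{0}$ be a $K$-quasiconformal mapping, and suppose $\Omega=f(\mathbb{D})$ is a bounded domain. For $z\in\mathbb{D}$ let $B(z)=\{\zeta:\ |z|\leq|\zeta|<1,\ |\arg z-\arg\zeta|\leq\pi(1-|z|)\}$. Then the following conditions are equivalent: (a) $\Omega$ is a radial John disk (with respect to $f$); (b) there is a positive constant $M_1$ such that, for all $z\in\mathbb{D}$, $$\operatorname{diam} f(B(z))\leq M_1\, d_\Omega(f(z));$$ (c) there are constants $\delta\in(0,1)$ and $M_2>0$ such that, for all $z\in\mathbb{D}$ and $\zeta\in B(z)$, $$\|D_f(\zeta)\|\leq M_2\,\|D_f(z)\|\left(\frac{1-|\zeta|}{1-|z|}\right)^{\delta-1}.$$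
   Context: $\mathbb{D}$ is the open unit disk in $\mathbb{C}$. A harmonic mapping in $\mathbb{D}$ is a complex-valued function whose real and imaginary parts are real harmonic; it can be written $f=h+\overline{g}$ with $h,g$ analytic, unique with $g(0)=0$. $\mathcal{S}_H$ is the family of sense-preserving univalent harmonic mappings $f=h+\overline{g}$ in $\mathbb{D}$ with $h(0)=g(0)=0$, $h'(0)=1$; $\mathcal{S}_H^{0}$ is the subfamily with $g'(0)=0$. $\|D_f\|=|f_z|+|f_{\overline z}|$, $l(D_f)=\big||f_z|-|f_{\overline z}|\big|$, where $f_z=\frac12(f_x-if_y)$, $f_{\overline z}=\frac12(f_x+if_y)$; $\det D_f=|f_z|^2-|f_{\overline z}|^2$. For $K\ge1$, a sense-preserving homeomorphism $f$ of a domain $\Omega_0$ onto a domain $\Omega_0'$, in the Sobolev class $W^{1,2}_{loc}(\Omega_0)$, is $K$-quasiconformal if $\|D_f(z)\|^2\le K\det D_f(z)$, i.e. $\|D_f(z)\|\le K\,l(D_f(z))$, for $z\in\Omega_0$. $d_\Omega(w)$ is the Euclidean distance from $w$ to $\partial\Omega$; $\operatorname{diam}$ is the Euclidean diameter. Differences of arguments are taken modulo $2\pi$, with values in $[-\pi,\pi]$, and $B(0)=\mathbb{D}$. Radial John disk: for a univalent map $f$ on $\mathbb{D}$ with bounded simply connected image $G=f(\mathbb{D})$, $G$ is a radial $c$-John disk ($c\ge1$), with John center $w_0=f(0)$, if for each $w_1=f(z_1)\in G$, $z_1\in\mathbb{D}$, the curve $\gamma=f([0,z_1])$ (the image of the radial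 segment from $0$ to $z_1$) is rectifiable and satisfies $\sigma_\ell(w)\le c\,d_G(w)$ for all $w$ on $\gamma$, where $\sigma_\ell(w)$ is the Euclidean length of the subarc $\gamma[w_1,w]$ of $\gamma$ between $w_1$ and $w$. $G$ is a radial John disk if it is a radial $c$-John disk for some $c\ge1$. *)

theory Defs
  imports "HOL-Complex_Analysis.Complex_Analysis"
begin

section \<open>Partial derivatives of functions on the plane\<close>

definition pderiv_dir :: "complex \<Rightarrow> (complex \<Rightarrow> 'b::real_normed_vector) \<Rightarrow> complex \<Rightarrow> 'b" where
  "pderiv_dir v f z = vector_derivative (\<lambda>t. f (z + t *\<^sub>R v)) (at 0)"

abbreviation pderiv_x :: "(complex \<Rightarrow> 'b::real_normed_vector) \<Rightarrow> complex \<Rightarrow> 'b" where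
  "pderiv_x \<equiv> pderiv_dir 1"

abbreviation pderiv_y :: "(complex \<Rightarrow> 'b::real_normed_vector) \<Rightarrow> complex \<Rightarrow> 'b" where
  "pderiv_y \<equiv> pderiv_dir \<i>"

definition deriv_z :: "(complex \<Rightarrow> complex) \<Rightarrow> complex \<Rightarrow> complex" where
  "deriv_z f z = (pderiv_x f z - \<i> * pderiv_y f z) / 2"

definition deriv_zbar :: "(complex \<Rightarrow> complex) \<Rightarrow> complex \<Rightarrow> complex" where
  "deriv_zbar f z = (pderiv_x f z + \<i> * pderiv_y f z) / 2"

definition norm_D :: "(complex \<Rightarrow> complex) \<Rightarrow> complex \<Rightarrow> real" where
  "norm_D f z = cmod (deriv_z f z) + cmod (deriv_zbar f z)"

definition det_D :: "(complex \<Rightarrow> complex) \<Rightarrow> complex \<Rightarrow> real" where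
  "det_D f z = (cmod (deriv_z f z))\<^sup>2 - (cmod (deriv_zbar f z))\<^sup>2"


section \<open>Univalent harmonic mappings of the disk\<close>

abbreviation unit_disk :: "complex set" where
  "unit_disk \<equiv> ball 0 1"

definition real_harmonic_on :: "(complex \<Rightarrow> real) \<Rightarrow> complex set \<Rightarrow> bool" where
  "real_harmonic_on u S \<longleftrightarrow>
     (\<forall>z\<in>S. u differentiable (at z)) \<and>
     (\<forall>v\<in>{1, \<i>}. \<forall>z\<in>S. pderiv_dir v u differentiable (at z)) \<and>
     (\<forall>v\<in>{1, \<i>}. \<forall>w\<in>{1, \<i>}. continuous_on S (pderiv_dir v (pderiv_dir w u))) \<and>
     (\<forall>z\<in>S. pderiv_x (pderiv_x u) z + pderiv_y (pderiv_y u) z = 0)"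

definition harmonic_mapping_on :: "(complex \<Rightarrow> complex) \<Rightarrow> complex set \<Rightarrow> bool" where
  "harmonic_mapping_on f S \<longleftrightarrow>
     real_harmonic_on (\<lambda>z. Re (f z)) S \<and> real_harmonic_on (\<lambda>z. Im (f z)) S"

text \<open>Orientation is expressed topologically, so that it makes sense for an arbitrary injective
  continuous map: the image of every positively oriented circle bounding a closed disk in \<open>S\<close> winds once, positively,
  around the image of its centre.\<close>

definition sense_preserving_on :: "(complex \<Rightarrow> complex) \<Rightarrow> complex set \<Rightarrow> bool" where
  "sense_preserving_on f S \<longleftrightarrow>
     (\<forall>z r. 0 < r \<and> cball z r \<subseteq> S \<longrightarrow> winding_number (f \<circ> circlepath z r) (f z) = 1)"

definition S_H :: "(complex \<Rightarrow> complex) set" where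
  "S_H = {f. harmonic_mapping_on f unit_disk \<and> inj_on f unit_disk \<and>
             sense_preserving_on f unit_disk \<and>
             (\<exists>h g. h holomorphic_on unit_disk \<and> g holomorphic_on unit_disk \<and>
                (\<forall>z\<in>unit_disk. f z = h z + cnj (g z)) \<and>
                h 0 = 0 \<and> g 0 = 0 \<and> deriv h 0 = 1)}"

text \<open>The decomposition with \<open>g 0 = 0\<close> is unique on the disk, so the existential quantifier below
  speaks about the same \<open>h\<close> and \<open>g\<close> as the one in the preceding definition.\<close>

definition S_H0 :: "(complex \<Rightarrow> complex) set" where
  "S_H0 = {f \<in> S_H. \<exists>h g. h holomorphic_on unit_disk \<and> g holomorphic_on unit_disk \<and>
                (\<forall>z\<in>unit_disk. f z = h z + cnj (g z)) \<and>
                h 0 = 0 \<and> g 0 = 0 \<and> deriv h 0 = 1 \<and> deriv g 0 = 0}"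


section \<open>Quasiconformal mappings\<close>

text \<open>\<open>C\<^sup>\<infinity>\<close>: every iterated partial derivative is (totally) differentiable.\<close>

definition smooth_plane :: "(complex \<Rightarrow> real) \<Rightarrow> bool" where
  "smooth_plane \<phi> \<longleftrightarrow>
     (\<forall>vs. set vs \<subseteq> {1, \<i>} \<longrightarrow> (\<forall>z. foldr pderiv_dir vs \<phi> differentiable (at z)))"

definition test_function_on :: "(complex \<Rightarrow> real) \<Rightarrow> complex set \<Rightarrow> bool" where
  "test_function_on \<phi> U \<longleftrightarrow>
     smooth_plane \<phi> \<and> (\<exists>C. compact C \<and> C \<subseteq> U \<and> (\<forall>z. z \<notin> C \<longrightarrow> \<phi> z = 0))"

definition L2_loc :: "(complex \<Rightarrow> complex) \<Rightarrow> complex set \<Rightarrow> bool" where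
  "L2_loc f U \<longleftrightarrow>
     (\<forall>C. compact C \<and> C \<subseteq> U \<longrightarrow>
        set_borel_measurable lebesgue C f \<and>
        set_integrable lebesgue C (\<lambda>z. (cmod (f z))\<^sup>2))"

definition weak_pderiv_dir ::
  "complex \<Rightarrow> (complex \<Rightarrow> complex) \<Rightarrow> (complex \<Rightarrow> complex) \<Rightarrow> complex set \<Rightarrow> bool" where
  "weak_pderiv_dir v f g U \<longleftrightarrow>
     (\<forall>\<phi>. test_function_on \<phi> U \<longrightarrow>
        (LINT z:U|lebesgue. pderiv_dir v \<phi> z *\<^sub>R f z) = - (LINT z:U|lebesgue. \<phi> z *\<^sub>R g z))"

definition W12_loc :: "(complex \<Rightarrow> complex) \<Rightarrow> complex set \<Rightarrow> bool" where
  "W12_loc f U \<longleftrightarrow>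
     L2_loc f U \<and> (\<forall>v\<in>{1, \<i>}. \<exists>g. L2_loc g U \<and> weak_pderiv_dir v f g U)"

text \<open>A homeomorphism in \<open>W12_loc\<close> is differentiable almost everywhere, and its classical partial
  derivatives agree almost everywhere with the weak ones. The dilatation inequality is therefore
  stated for the classical derivatives, off a null set.\<close>

definition quasiconformal ::
  "real \<Rightarrow> (complex \<Rightarrow> complex) \<Rightarrow> complex set \<Rightarrow> complex set \<Rightarrow> bool" where
  "quasiconformal K f U V \<longleftrightarrow>
     K \<ge> 1 \<and>
     open U \<and> connected U \<and> U \<noteq> {} \<and> open V \<and> connected V \<and>
     (\<exists>g. homeomorphism U V f g) \<and>
     sense_preserving_on f U \<and>
     W12_loc f U \<and>
     (AE z in lebesgue. z \<in> U \<longrightarrow> (norm_D f z)\<^sup>2 \<le> K * det_D f z)"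


section \<open>Radial John disks\<close>

definition curve_length :: "(real \<Rightarrow> complex) \<Rightarrow> real \<Rightarrow> real \<Rightarrow> ennreal" where
  "curve_length \<gamma> a b =
     (SUP ts \<in> {ts. sorted ts \<and> set ts \<subseteq> {a..b}}.
        ennreal (\<Sum>i<length ts - 1. dist (\<gamma> (ts ! i)) (\<gamma> (ts ! Suc i))))"

definition bdry_dist :: "complex set \<Rightarrow> complex \<Rightarrow> real" where
  "bdry_dist \<Omega> w = infdist w (frontier \<Omega>)"

text \<open>For \<open>z\<^sub>1\<close> in the disk, \<open>\<gamma> = f \<circ> linepath 0 z\<^sub>1\<close> runs from \<open>f 0\<close> to \<open>w\<^sub>1 = f z\<^sub>1\<close>, and the
  subarc between \<open>w = \<gamma> t\<close> and \<open>w\<^sub>1\<close> is \<open>\<gamma>\<close> restricted to \<open>{t..1}\<close>. The notion is meant for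
  \<open>f\<close> univalent on the disk with a bounded simply connected image.\<close>

definition radial_c_John_disk :: "real \<Rightarrow> (complex \<Rightarrow> complex) \<Rightarrow> bool" where
  "radial_c_John_disk c f \<longleftrightarrow>
     c \<ge> 1 \<and>
     (\<forall>z\<^sub>1\<in>unit_disk.
        curve_length (f \<circ> linepath 0 z\<^sub>1) 0 1 < \<infinity> \<and>
        (\<forall>t\<in>{0..1}. curve_length (f \<circ> linepath 0 z\<^sub>1) t 1
                     \<le> ennreal (c * bdry_dist (f ` unit_disk) ((f \<circ> linepath 0 z\<^sub>1) t))))"

definition radial_John_disk :: "(complex \<Rightarrow> complex) \<Rightarrow> bool" where
  "radial_John_disk f \<longleftrightarrow> (\<exists>c. radial_c_John_disk c f)"


section \<open>The boxes \<open>B(z)\<close>\<close>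

text \<open>The integer \<open>k\<close> reduces the difference of arguments modulo \<open>2\<pi>\<close>. Since \<open>Arg 0 = 0\<close> and
  \<open>\<bar>Arg \<zeta>\<bar> \<le> \<pi>\<close>, the definition gives the whole unit disk for \<open>z = 0\<close>.\<close>

definition Bbox :: "complex \<Rightarrow> complex set" where
  "Bbox z = {\<zeta>. cmod z \<le> cmod \<zeta> \<and> cmod \<zeta> < 1 \<and>
                 (\<exists>k::int. \<bar>Arg z - Arg \<zeta> + 2 * pi * of_int k\<bar> \<le> pi * (1 - cmod z))}"

lemma Bbox_0: "Bbox 0 = unit_disk"
proof -
  have "\<exists>k::int. \<bar>Arg 0 - Arg \<zeta> + 2 * pi * of_int k\<bar> \<le> pi * (1 - cmod 0)" for \<zeta>
    using Arg_bounded[of \<zeta>] by (intro exI[of _ 0]) (auto simp: Arg_zero)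
  then show ?thesis by (auto simp: Bbox_def)
qed

end

theory Submission
  imports Defs
begin

text \<open>Write \<open>f = h + cnj g\<close>. Quasiconformality gives \<open>\<bar>g'\<bar> \<le> k \<bar>h'\<bar>\<close> with
\<open>k = (K - 1) / (K + 1) < 1\<close>, so that \<open>norm_D f\<close> is comparable to \<open>\<bar>h'\<bar>\<close>. Everything is then
expressed through the single quantity \<open>\<lambda>(z) = (1 - \<bar>z\<bar>) \<bar>h'(z)\<bar>\<close>, for which two facts known for
conformal maps are needed, with constants that do not depend on \<open>z\<close>.

\<^item> Distortion (\<open>pre_schwarzian_bound\<close>, \<open>harnack\<close>): \<open>(1 - \<bar>z\<bar>) \<bar>h''/h'\<bar>\<close> is bounded, so \<open>\<bar>h'\<bar>\<close> varies by
a bounded factor on hyperbolic disks of bounded radius and on the arcs \<open>{r cis t}\<close> of length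
comparable to \<open>1 - r\<close>. If it were unbounded, rescaling \<open>f\<close> at a point where a weighted version of
this quantity is maximal would give an injective map arbitrarily close to an affine image of the exponential
function on a large disk, which takes some value twice because \<open>exp\<close> has period \<open>2 pi \<i>\<close>.

\<^item> Koebe estimates (\<open>koebe_lower\<close>, \<open>koebe_upper\<close>): \<open>\<lambda>(z)\<close> is comparable to the distance from \<open>f z\<close> to the
boundary of the image. The lower estimate of the distance holds because near \<open>z\<close> the increment of \<open>h\<close> is nearly
linear and dominates that of \<open>g\<close>.
The upper one uses that on a convex subset of the image the map \<open>h \<circ> f\<^sup>-\<^sup>1\<close> is strongly monotone;
its inverse, composed with \<open>f\<^sup>-\<^sup>1\<close>, is a holomorphic map of a disk of radius comparable to the distance
into the unit disk, and the Schwarz-Pick lemma applies to it.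

The equivalence follows from three implications. (a) implies (b): a point of \<open>B(z)\<close> is reached from \<open>z\<close>
along an arc, whose image is short by distortion, and then along a radius, whose image is short by the John
condition. (b) implies (c): on one radius let \<open>W\<^sub>0, W\<^sub>1, \<dots>\<close> be points whose distances to the unit circle halve
successively. The image of \<open>B(W\<^sub>n)\<close> has diameter at most a constant times \<open>\<lambda>(W\<^sub>n)\<close>
and contains disjoint disks of radii comparable to \<open>\<lambda>(W\<^sub>m)\<close> for all \<open>m > n\<close>. Comparing areas bounds each tail
sum of \<open>\<lambda>(W\<^sub>m)\<^sup>2\<close> by its preceding term, hence \<open>\<lambda>(W\<^sub>n)\<close> decays geometrically, which is (c).
(c) implies (a): integrate the bound along a radius.\<close>

section \<open>The derivatives of \<open>h + cnj g\<close>\<close>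

lemma continuous_on_harmonic:
  assumes "h holomorphic_on S" "g holomorphic_on S" "\<And>z. z \<in> S \<Longrightarrow> f z = h z + cnj (g z)"
  shows "continuous_on S f"
proof (rule continuous_on_eq)
  show "continuous_on S (\<lambda>z. h z + cnj (g z))"
    using assms(1,2) by (intro continuous_intros holomorphic_on_imp_continuous_on)
qed (simp add: assms(3))

lemma has_derivative_harmonic:
  assumes S: "open S" and hol: "h holomorphic_on S" "g holomorphic_on S"
    and f_eq: "\<And>z. z \<in> S \<Longrightarrow> f z = h z + cnj (g z)" and z: "z \<in> S"
  shows "(f has_derivative (\<lambda>v. deriv h z * v + cnj (deriv g z * v))) (at z)"
proof (rule has_derivative_transform_within_open[OF _ S z])
  have 1: "(h has_derivative (\<lambda>v. deriv h z * v)) (at z)" "(g has_derivative (\<lambda>v. deriv g z * v)) (at z)"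
    using holomorphic_derivI[OF hol(1) S z] holomorphic_derivI[OF hol(2) S z]
    by (simp_all add: has_field_derivative_def)
  show "((\<lambda>z. h z + cnj (g z)) has_derivative (\<lambda>v. deriv h z * v + cnj (deriv g z * v))) (at z)"
    by (intro has_derivative_add 1 has_derivative_cnj)
qed (use f_eq in auto)

lemma harmonic_wirtinger_derivs:
  assumes "(f has_derivative (\<lambda>v. a * v + cnj (b * v))) (at z)"
  shows "deriv_z f z = a" "deriv_zbar f z = cnj b"
proof -
  have "pderiv_dir v f z = a * v + cnj (b * v)" for v
  proof -
    have "((\<lambda>t. z + t *\<^sub>R v) has_vector_derivative v) (at (0::real))"
      by (auto simp: has_vector_derivative_def intro!: derivative_eq_intros)
    moreover have "(f has_derivative (\<lambda>v. a * v + cnj (b * v))) (at (z + 0 *\<^sub>R v))"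
      using assms by simp
    ultimately have "(f \<circ> (\<lambda>t. z + t *\<^sub>R v) has_vector_derivative a * v + cnj (b * v)) (at 0)"
      using vector_derivative_diff_chain_within[of "\<lambda>t. z + t *\<^sub>R v" v 0 UNIV f] has_derivative_at_withinI
      by blast
    then show ?thesis
      unfolding pderiv_dir_def by (intro vector_derivative_at) (simp add: o_def)
  qed
  then show "deriv_z f z = a" "deriv_zbar f z = cnj b"
    unfolding deriv_z_def deriv_zbar_def by (simp_all add: algebra_simps)
qed

section \<open>Estimates for holomorphic functions\<close>

text \<open>Cauchy's estimate on disks of radius \<open>R / 2\<close>: a function bounded on a large disk is nearly constant
  close to its centre.\<close>

lemma holomorphic_dist_center_le:
  fixes p :: "complex \<Rightarrow> complex"
  assumes hol: "p holomorphic_on ball 0 R" and bd: "\<And>\<zeta>. \<zeta> \<in> ball 0 R \<Longrightarrow> cmod (p \<zeta>) \<le> B"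
    and \<zeta>: "cmod \<zeta> < R / 2"
  shows "cmod (p \<zeta> - p 0) \<le> 2 * B / R * cmod \<zeta>"
proof -
  have R: "R > 0" using \<zeta> norm_ge_zero[of \<zeta>] by linarith
  have deriv_le: "cmod (deriv p z) \<le> 2 * B / R" if z: "z \<in> ball 0 (R/2)" for z
  proof -
    have sub: "cball z (R/2) \<subseteq> ball 0 R"
    proof
      fix x assume "x \<in> cball z (R/2)"
      then have "cmod (x - z) \<le> R/2" by (simp add: dist_norm norm_minus_commute)
      then show "x \<in> ball 0 R"
        using z norm_triangle_ineq[of z "x - z"] by simp
    qed
    have "cmod ((deriv ^^ 1) p z) \<le> fact 1 * B / (R/2)^1"
    proof (rule Cauchy_inequality)
      show "p holomorphic_on ball z (R/2)"
        using hol sub ball_subset_cball holomorphic_on_subset by blast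
      show "continuous_on (cball z (R/2)) p"
        using hol sub holomorphic_on_imp_continuous_on holomorphic_on_subset by blast
      show "cmod (p x) \<le> B" if "cmod (z - x) = R/2" for x
        using that sub by (intro bd) (auto simp: dist_norm)
    qed (use R in auto)
    then show ?thesis by (simp add: mult.commute)
  qed
  have "cmod (p \<zeta> - p 0) \<le> 2 * B / R * cmod (\<zeta> - 0)"
  proof (rule field_differentiable_bound[where S = "ball 0 (R/2)" and f' = "deriv p"])
    show "(p has_field_derivative deriv p z) (at z within ball 0 (R/2))" if "z \<in> ball 0 (R/2)" for z
      using that R by (auto intro!: holomorphic_derivI[OF hol])
  qed (use \<zeta> R in \<open>simp_all add: deriv_le\<close>)
  then show ?thesis by simp
qed

lemma norm_exp_minus_one_le:
  fixes z :: complex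
  assumes "cmod z \<le> 1/2"
  shows "cmod (exp z - 1) \<le> 2 * cmod z"
proof -
  have "cmod (exp z - exp 0) \<le> 2 * cmod (z - 0)"
    by (rule field_differentiable_bound[where S = "cball 0 (1/2)" and f' = exp])
       (use assms in \<open>auto simp del: norm_exp_eq_Re intro!: derivative_eq_intros exp_bound_half\<close>)
  then show ?thesis by simp
qed

text \<open>Only the logarithmic derivative of \<open>u\<close> is controlled in the applications, so the logarithm is normalised to
  vanish at the reference point \<open>c\<close>.\<close>

lemma holomorphic_log_on_convex:
  fixes u :: "complex \<Rightarrow> complex"
  assumes hol: "u holomorphic_on S" and S: "open S" "convex S" "c \<in> S"
    and nz: "\<And>z. z \<in> S \<Longrightarrow> u z \<noteq> 0"
  obtains q where "q c = 0" "\<And>z. z \<in> S \<Longrightarrow> u z = u c * exp (q z)"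
    "\<And>z. z \<in> S \<Longrightarrow> (q has_field_derivative deriv u z / u z) (at z)"
proof -
  obtain l where l: "l holomorphic_on S" "\<And>z. z \<in> S \<Longrightarrow> u z = exp (l z)"
    using contractible_imp_holomorphic_log[OF hol convex_imp_contractible[OF S(2)] nz] by auto
  define q where "q = (\<lambda>z. l z - l c)"
  have u: "u z = u c * exp (q z)" if "z \<in> S" for z
    using l(2)[OF that] l(2)[OF S(3)] by (simp add: q_def flip: exp_add)
  have "(q has_field_derivative deriv u z / u z) (at z)" if z: "z \<in> S" for z
  proof -
    have dl: "(l has_field_derivative deriv l z) (at z)"
      using l(1) S(1) z holomorphic_derivI by blast
    then have "((\<lambda>z. exp (l z)) has_field_derivative exp (l z) * deriv l z) (at z)"
      by (auto intro!: derivative_eq_intros)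
    then have "(u has_field_derivative exp (l z) * deriv l z) (at z)"
      by (rule has_field_derivative_transform_within_open[OF _ S(1) z]) (simp add: l)
    then have "deriv u z = u z * deriv l z"
      by (simp add: DERIV_imp_deriv l(2)[OF z])
    then have "deriv l z = deriv u z / u z" using nz[OF z] by simp
    then show ?thesis
      using dl by (auto simp: q_def intro!: derivative_eq_intros)
  qed
  then show thesis using that[of q] u by (simp add: q_def)
qed

text \<open>Integration of the bound along the segment from \<open>z\<close> to \<open>w\<close>. It is sharp for a pure power, which
  is what makes the comparison with the leading term of a Taylor expansion work later.\<close>

lemma norm_diff_le_of_deriv_power_bound:
  fixes F :: "complex \<Rightarrow> complex"
  assumes F: "\<And>w. w \<in> ball z r \<Longrightarrow> (F has_field_derivative F' w) (at w)"
    and bd: "\<And>w. cmod (w - z) \<le> s \<Longrightarrow> cmod (F' w) \<le> B * cmod (w - z) ^ n"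
    and w: "cmod (w - z) = s" "s < r"
  shows "cmod (F w - F z) \<le> B * s ^ Suc n / Suc n"
proof -
  define v where "v = w - z"
  have v: "cmod v = s" using w by (simp add: v_def)
  have s0: "s \<ge> 0" using v norm_ge_zero[of v] by simp
  define p where "p = (\<lambda>t::real. z + of_real t * v)"
  have p: "p t \<in> ball z r" "cmod (p t - z) = t * s" "t * s \<le> s" if "0 \<le> t" "t \<le> 1" for t
  proof -
    show *: "cmod (p t - z) = t * s" using that by (simp add: p_def norm_mult v)
    show "t * s \<le> s" using that s0 by (simp add: mult_left_le_one_le)
    then show "p t \<in> ball z r" using w(2) * by (simp add: dist_norm norm_minus_commute)
  qed
  have dF: "((\<lambda>t. F (p t)) has_vector_derivative v * F' (p t)) (at t)" if t: "0 \<le> t" "t \<le> 1" for t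
  proof -
    have "(p has_vector_derivative v) (at t)"
      unfolding p_def by (auto simp: has_vector_derivative_def scaleR_conv_of_real intro!: derivative_eq_intros)
    from field_vector_diff_chain_at[OF this F[OF p(1)[OF t]]] show ?thesis by (simp add: o_def)
  qed
  have dB: "((\<lambda>t. B * s ^ Suc n / Suc n * t ^ Suc n) has_vector_derivative B * s ^ Suc n * t ^ n) (at t)" for t
  proof -
    have "((\<lambda>t. B * s ^ Suc n / Suc n * t ^ Suc n) has_real_derivative B * s ^ Suc n / Suc n * (Suc n * t ^ n)) (at t)"
      by (rule DERIV_cmult) (auto intro!: derivative_eq_intros simp del: power_Suc)
    moreover have "B * s ^ Suc n / Suc n * (Suc n * t ^ n) = B * s ^ Suc n * t ^ n"
      by (simp del: of_nat_Suc)
    ultimately show ?thesis by (simp only: has_real_derivative_iff_has_vector_derivative)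
  qed
  have "cmod (F (p 1) - F (p 0)) \<le> B * s ^ Suc n / Suc n * 1 ^ Suc n - B * s ^ Suc n / Suc n * 0 ^ Suc n"
  proof (rule differentiable_bound_general[where f = "\<lambda>t. F (p t)" and \<phi> = "\<lambda>t. B * s ^ Suc n / Suc n * t ^ Suc n"
        and f' = "\<lambda>t. v * F' (p t)" and \<phi>' = "\<lambda>t. B * s ^ Suc n * t ^ n"])
    show "continuous_on {0..1} (\<lambda>t. F (p t))"
      by (intro continuous_at_imp_continuous_on ballI has_vector_derivative_continuous[OF dF]) auto
    show "continuous_on {0..1} (\<lambda>t. B * s ^ Suc n / Suc n * t ^ Suc n)" by (intro continuous_intros) auto
    fix t :: real assume t: "0 < t" "t < 1"
    show "((\<lambda>t. F (p t)) has_vector_derivative v * F' (p t)) (at t)" using t by (intro dF) auto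
    show "((\<lambda>t. B * s ^ Suc n / Suc n * t ^ Suc n) has_vector_derivative B * s ^ Suc n * t ^ n) (at t)" by (rule dB)
    have "cmod (F' (p t)) \<le> B * (t * s) ^ n" using bd[of "p t"] p(2,3)[of t] t by simp
    then have "s * cmod (F' (p t)) \<le> s * (B * (t * s) ^ n)" using s0 by (rule mult_left_mono)
    then show "cmod (v * F' (p t)) \<le> B * s ^ Suc n * t ^ n"
      by (simp add: norm_mult v power_mult_distrib mult_ac)
  qed auto
  then show ?thesis by (simp add: p_def v_def)
qed

section \<open>Dilatation and critical points\<close>

text \<open>Both sides of the dilatation inequality are continuous, so the exceptional null set is open,
  and an open null set is empty. Cancelling \<open>\<bar>h'\<bar> + \<bar>g'\<bar>\<close> leaves \<open>\<bar>h'\<bar> + \<bar>g'\<bar> \<le> K (\<bar>h'\<bar> - \<bar>g'\<bar>)\<close>.\<close>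

lemma dilatation_bound_everywhere:
  assumes hol: "h holomorphic_on ball 0 1" "g holomorphic_on ball 0 1" and K: "K \<ge> 1"
    and AE: "AE z in lebesgue. z \<in> ball 0 1 \<longrightarrow>
       (cmod (deriv h z) + cmod (deriv g z))\<^sup>2 \<le> K * ((cmod (deriv h z))\<^sup>2 - (cmod (deriv g z))\<^sup>2)"
    and z: "z \<in> ball 0 1"
  shows "cmod (deriv g z) \<le> (K - 1) / (K + 1) * cmod (deriv h z)"
proof -
  define \<phi> where "\<phi> = (\<lambda>z. (cmod (deriv h z) + cmod (deriv g z))\<^sup>2 - K * ((cmod (deriv h z))\<^sup>2 - (cmod (deriv g z))\<^sup>2))"
  define S where "S = ball 0 1 \<inter> \<phi> -` {0<..}"
  have "continuous_on (ball 0 1) \<phi>"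
    unfolding \<phi>_def using hol by (intro continuous_intros holomorphic_on_imp_continuous_on holomorphic_deriv) auto
  then have "open S" unfolding S_def by (rule continuous_open_preimage) auto
  obtain N where N: "negligible N" "S \<subseteq> N"
    using AE unfolding eventually_ae_filter_negligible by (force simp: S_def \<phi>_def not_le)
  then have "negligible S" using negligible_subset by blast
  then have "S = {}" using open_not_negligible[OF \<open>open S\<close>] by blast
  then have le: "(cmod (deriv h z) + cmod (deriv g z))\<^sup>2 \<le> K * ((cmod (deriv h z))\<^sup>2 - (cmod (deriv g z))\<^sup>2)"
    using z by (auto simp: S_def \<phi>_def)
  define a where "a = cmod (deriv h z)"
  define b where "b = cmod (deriv g z)"
  have ab: "a \<ge> 0" "b \<ge> 0" by (auto simp: a_def b_def)
  have "b * (K + 1) \<le> a * (K - 1)"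
  proof (cases "a + b = 0")
    case True
    then have "a = 0" "b = 0" using ab by linarith+
    then show ?thesis by simp
  next
    case False
    have "(a + b) * (a + b) \<le> (a + b) * (K * (a - b))"
      using le unfolding a_def[symmetric] b_def[symmetric] by (simp add: power2_eq_square algebra_simps)
    then have "a + b \<le> K * (a - b)" using False ab by (simp add: mult_le_cancel_left_pos)
    then show ?thesis by (simp add: algebra_simps)
  qed
  then have "b \<le> (K - 1) / (K + 1) * a" using K by (simp add: field_simps)
  then show ?thesis by (simp add: a_def b_def)
qed

lemma winding_number_power_loop:
  assumes "C \<noteq> 0"
  shows "winding_number (\<lambda>t. w + C * exp (2 * of_real pi * \<i> * of_real t) ^ n) w = of_nat n"
proof -
  define p where "p = (\<lambda>t::real. Ln C + of_nat n * (2 * of_real pi * \<i> * of_real t))"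
  have "path p" unfolding path_def p_def by (intro continuous_intros)
  have "winding_number (\<lambda>t. w + C * exp (2 * of_real pi * \<i> * of_real t) ^ n) w = winding_number (exp \<circ> p) 0"
    using assms
    by (subst winding_number_offset) (simp add: o_def p_def exp_add exp_of_nat_mult)
  also have "\<dots> = (pathfinish p - pathstart p) / (2 * of_real pi * \<i>)"
    by (rule winding_number_compose_exp[OF \<open>path p\<close>])
  also have "\<dots> = of_nat n" by (simp add: p_def pathfinish_def pathstart_def)
  finally show ?thesis .
qed

text \<open>A form of Lewy's theorem. At a zero of \<open>h'\<close> of order \<open>n\<close> the leading term of \<open>h - h(z\<^sub>0)\<close> is a multiple of the
  power \<open>n + 1\<close>, and the dilatation bound keeps \<open>g - g(z\<^sub>0)\<close> smaller than that on small circles. The image of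
  such a circle therefore winds \<open>n + 1\<close> times around \<open>f(z\<^sub>0)\<close>, while orientation allows only one turn.\<close>

lemma deriv_nonzero_of_sense_preserving:
  assumes hol: "h holomorphic_on ball 0 1" "g holomorphic_on ball 0 1"
    and f_eq: "\<And>z. z \<in> ball 0 1 \<Longrightarrow> f z = h z + cnj (g z)"
    and k: "0 \<le> k" "k < 1"
    and dil: "\<And>z. z \<in> ball 0 1 \<Longrightarrow> cmod (deriv g z) \<le> k * cmod (deriv h z)"
    and sp: "sense_preserving_on f (ball 0 1)" and h0: "deriv h 0 \<noteq> 0"
    and z0: "z0 \<in> ball 0 1"
  shows "deriv h z0 \<noteq> 0"
proof
  assume zero: "deriv h z0 = 0"
  have hol': "deriv h holomorphic_on ball 0 1" by (rule holomorphic_deriv[OF hol(1) open_ball])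
  have "\<not> deriv h constant_on ball 0 1"
    using h0 zero z0 by (metis centre_in_ball constant_on_def zero_less_one)
  then obtain u r n where n: "0 < n" and r: "0 < r" "ball z0 r \<subseteq> ball 0 1"
    and u: "u holomorphic_on ball z0 r" "\<And>w. w \<in> ball z0 r \<Longrightarrow> deriv h w = (w - z0) ^ n * u w"
      "\<And>w. w \<in> ball z0 r \<Longrightarrow> u w \<noteq> 0"
    using holomorphic_factor_zero_nonconstant[OF hol' open_ball connected_ball z0 zero] by metis
  define c where "c = u z0"
  have c0: "cmod c > 0" using u(3)[of z0] r by (simp add: c_def)
  define \<eta> where "\<eta> = (1 - k) / 4"
  have \<eta>: "\<eta> > 0" using k by (simp add: \<eta>_def)
  have "isCont u z0"
    using holomorphic_on_imp_continuous_on[OF u(1)] r(1) continuous_on_eq_continuous_at[OF open_ball] centre_in_ball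
    by blast
  moreover have "\<eta> * cmod c > 0" using \<eta> c0 by simp
  ultimately obtain s' where s': "s' > 0" "\<And>w. dist w z0 < s' \<Longrightarrow> dist (u w) (u z0) < \<eta> * cmod c"
    unfolding continuous_at_eps_delta by blast
  define s where "s = min s' r / 2"
  have s: "0 < s" "s < s'" "s < r" using s' r by (auto simp: s_def)
  have in_ball: "w \<in> ball z0 r" "w \<in> ball 0 1" "cmod (u w - c) \<le> \<eta> * cmod c" if "cmod (w - z0) \<le> s" for w
  proof -
    show "w \<in> ball z0 r" using that s by (simp add: dist_norm norm_minus_commute)
    then show "w \<in> ball 0 1" using r by blast
    show "cmod (u w - c) \<le> \<eta> * cmod c" using s'(2)[of w] that s by (simp add: dist_norm c_def)
  qed
  have dP: "((\<lambda>w. c / of_nat (Suc n) * (w - z0) ^ Suc n) has_field_derivative c * (w - z0) ^ n) (at w)" for w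
  proof -
    have "((\<lambda>w. c / of_nat (Suc n) * (w - z0) ^ Suc n) has_field_derivative
        c / of_nat (Suc n) * (of_nat (Suc n) * (w - z0) ^ n)) (at w)"
      by (rule DERIV_cmult) (auto intro!: derivative_eq_intros simp del: power_Suc of_nat_Suc)
    moreover have "c / of_nat (Suc n) * (of_nat (Suc n) * (w - z0) ^ n) = c * (w - z0) ^ n"
      by (simp del: of_nat_Suc)
    ultimately show ?thesis by (simp only:)
  qed
  (* the leading term of h - h(z0) *)
  define P where "P = (\<lambda>w. c / of_nat (Suc n) * (w - z0) ^ Suc n)"
  (* a is the modulus of the leading term P on the circle of radius s *)
  define a where "a = cmod c * s ^ Suc n / Suc n"
  have a0: "a > 0" using c0 s by (simp add: a_def)
  have err: "cmod (f w - (f z0 + P w)) < a" if w: "cmod (w - z0) = s" for w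
  proof -
    have "cmod ((h w - P w) - (h z0 - P z0)) \<le> (\<eta> * cmod c) * s ^ Suc n / Suc n"
    proof (rule norm_diff_le_of_deriv_power_bound[OF _ _ w s(3), where F = "\<lambda>w. h w - P w" and F' = "\<lambda>w. deriv h w - c * (w - z0) ^ n"])
      show "((\<lambda>w. h w - P w) has_field_derivative deriv h x - c * (x - z0) ^ n) (at x)" if "x \<in> ball z0 r" for x
        unfolding P_def using that r by (intro DERIV_diff holomorphic_derivI[OF hol(1) open_ball] dP) auto
      show "cmod (deriv h x - c * (x - z0) ^ n) \<le> \<eta> * cmod c * cmod (x - z0) ^ n" if "cmod (x - z0) \<le> s" for x
      proof -
        have "deriv h x - c * (x - z0) ^ n = (u x - c) * (x - z0) ^ n"
          using u(2)[OF in_ball(1)[OF that]] by (simp add: algebra_simps)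
        then show ?thesis
          using in_ball(3)[OF that] by (simp add: norm_mult norm_power mult_right_mono)
      qed
    qed
    then have e1: "cmod (h w - h z0 - P w) \<le> \<eta> * a" by (simp add: P_def a_def algebra_simps)
    have "cmod (g w - g z0) \<le> (k * ((1 + \<eta>) * cmod c)) * s ^ Suc n / Suc n"
    proof (rule norm_diff_le_of_deriv_power_bound[OF _ _ w s(3), where F = g and F' = "deriv g"])
      show "(g has_field_derivative deriv g x) (at x)" if "x \<in> ball z0 r" for x
        using that r by (intro holomorphic_derivI[OF hol(2) open_ball]) auto
      show "cmod (deriv g x) \<le> k * ((1 + \<eta>) * cmod c) * cmod (x - z0) ^ n" if "cmod (x - z0) \<le> s" for x
      proof -
        have "cmod (u x) \<le> (1 + \<eta>) * cmod c"
          using in_ball(3)[OF that] norm_triangle_ineq[of c "u x - c"] by (simp add: algebra_simps)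
        then have "cmod (deriv h x) \<le> (1 + \<eta>) * cmod c * cmod (x - z0) ^ n"
          using u(2)[OF in_ball(1)[OF that]] by (simp add: norm_mult norm_power mult.commute mult_right_mono)
        then have "k * cmod (deriv h x) \<le> k * ((1 + \<eta>) * cmod c * cmod (x - z0) ^ n)"
          using k by (intro mult_left_mono) auto
        then show ?thesis using dil[OF in_ball(2)[OF that]] by (simp add: mult.assoc)
      qed
    qed
    then have e2: "cmod (cnj (g w - g z0)) \<le> k * (1 + \<eta>) * a" unfolding complex_mod_cnj by (simp add: a_def mult.assoc)
    have "f w - (f z0 + P w) = (h w - h z0 - P w) + cnj (g w - g z0)"
      using f_eq[OF in_ball(2)[of w]] f_eq[OF z0] w by simp
    then have "cmod (f w - (f z0 + P w)) \<le> \<eta> * a + k * (1 + \<eta>) * a"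
      by (simp only: norm_triangle_le[OF add_mono[OF e1 e2]])
    also have "\<dots> = (\<eta> + k * (1 + \<eta>)) * a" by (simp add: algebra_simps)
    also have "\<dots> < 1 * a"
    proof (rule mult_strict_right_mono[OF _ a0])
      have "k * \<eta> \<le> 1 * \<eta>" using k \<eta> by (intro mult_right_mono) auto
      moreover have "k * (1 + \<eta>) = k + k * \<eta>" "4 * \<eta> = 1 - k" by (simp_all add: \<eta>_def field_simps)
      ultimately show "\<eta> + k * (1 + \<eta>) < 1" using k \<eta> by linarith
    qed
    finally show ?thesis by simp
  qed
  define C where "C = c / of_nat (Suc n) * of_real s ^ Suc n"
  have C0: "C \<noteq> 0" using c0 s by (simp add: C_def del: of_nat_Suc)
  define Q where "Q = (\<lambda>t::real. f z0 + C * exp (2 * of_real pi * \<i> * of_real t) ^ Suc n)"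
  have circ: "cmod (circlepath z0 s t - z0) = s" for t
    using s by (simp add: circlepath norm_mult)
  have Q_eq: "Q t = f z0 + P (circlepath z0 s t)" for t
    by (simp add: Q_def P_def C_def circlepath power_mult_distrib mult_ac del: of_nat_Suc)
  have sub: "cball z0 s \<subseteq> ball 0 1" using in_ball(2) by (auto simp: dist_norm norm_minus_commute)
  have contf: "continuous_on (ball 0 1) f" by (rule continuous_on_harmonic[OF hol f_eq])
  have "winding_number (f \<circ> circlepath z0 s) (f z0) = winding_number Q (f z0)"
  proof (rule winding_number_nearby_loops_eq)
    show "path Q" unfolding path_def Q_def by (intro continuous_intros)
    show "path (f \<circ> circlepath z0 s)"
      using in_ball(2) s by (intro path_continuous_image continuous_on_subset[OF contf])
        (auto simp: sphere_def dist_norm norm_minus_commute)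
    show "pathfinish Q = pathstart Q"
      by (simp add: Q_def pathfinish_def pathstart_def exp_two_pi_i)
    show "pathfinish (f \<circ> circlepath z0 s) = pathstart (f \<circ> circlepath z0 s)"
      by (simp add: pathfinish_compose pathstart_compose)
    show "cmod ((f \<circ> circlepath z0 s) t - Q t) < cmod (Q t - f z0)" for t
    proof -
      have "cmod (Q t - f z0) = a"
        using s by (simp add: Q_def C_def a_def norm_mult norm_divide norm_power del: of_nat_Suc)
      then show ?thesis using err[OF circ[of t]] by (simp add: Q_eq)
    qed
  qed
  also have "\<dots> = of_nat (Suc n)" unfolding Q_def by (rule winding_number_power_loop[OF C0])
  finally have "of_nat (Suc n) = (1::complex)"
    using sp s sub unfolding sense_preserving_on_def by metis
  then have "Suc n = 1" using of_nat_eq_1_iff by blast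
  then show False using n by simp
qed

section \<open>Perturbations of the exponential function are not injective\<close>

text \<open>The contradiction at the end of the rescaling argument, in quantitative form. The logarithm \<open>q\<close> of \<open>H'\<close> has
  derivative bounded by 2 on a huge disk and equal to 1 at 0; hence \<open>q\<close> is close to the identity on the disk of
  radius 8, \<open>H\<close> is close to \<open>E = exp - 1\<close> there, and \<open>\<omega> = G'/H'\<close> is close to the constant \<open>\<omega>0\<close>. So
  \<open>H + cnj G\<close> is close to \<open>E + cnj (\<omega>0 E)\<close>, up to an additive constant. The exact map has a zero at
  \<open>2 pi \<i>\<close> besides 0, and Brouwer's theorem shows that the perturbed one keeps it. The radius 8 is chosen to
  contain the disk of radius 1 about \<open>2 pi \<i>\<close>; the bound on \<open>R\<close> makes all errors small compared with \<open>1 - k\<close>.\<close>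

lemma almost_exponential_not_inj:
  fixes H G :: "complex \<Rightarrow> complex"
  assumes k: "0 \<le> k" "k < 1" and R: "R \<ge> 36000 * exp 8 / (1 - k)"
    and hol: "H holomorphic_on ball 0 R" "G holomorphic_on ball 0 R"
    and nz: "\<And>\<zeta>. \<zeta> \<in> ball 0 R \<Longrightarrow> deriv H \<zeta> \<noteq> 0"
    and dil: "\<And>\<zeta>. \<zeta> \<in> ball 0 R \<Longrightarrow> cmod (deriv G \<zeta>) \<le> k * cmod (deriv H \<zeta>)"
    and pre: "\<And>\<zeta>. \<zeta> \<in> ball 0 R \<Longrightarrow> cmod (deriv (deriv H) \<zeta>) \<le> 2 * cmod (deriv H \<zeta>)"
    and norm0: "deriv H 0 = 1" "deriv (deriv H) 0 = 1"
  shows "\<not> inj_on (\<lambda>\<zeta>. H \<zeta> + cnj (G \<zeta>)) (ball 0 R)"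
proof
  assume inj: "inj_on (\<lambda>\<zeta>. H \<zeta> + cnj (G \<zeta>)) (ball 0 R)"
  define e8 where "e8 = exp (8::real)"
  have e8: "e8 \<ge> 1" by (simp add: e8_def)
  have Re8: "36000 * e8 \<le> R * (1 - k)" using R k by (simp add: e8_def field_simps)
  have "0 \<le> R" using R k by (smt (verit) divide_nonneg_pos exp_gt_zero mult_nonneg_nonneg)
  then have "R * (1 - k) \<le> R" using k by (simp add: mult_left_le)
  then have R': "R \<ge> 36000 * e8" "R \<ge> 36000" using Re8 e8 by linarith+
  then have R0: "R > 0" by linarith
  have in_ball: "\<zeta> \<in> ball 0 R" "cmod \<zeta> < R / 2" if "\<zeta> \<in> cball 0 8" for \<zeta>
    using that R' by auto
  have holH': "deriv H holomorphic_on ball 0 R" and holG': "deriv G holomorphic_on ball 0 R"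
    using hol by (auto intro: holomorphic_deriv)
  obtain q where q: "q 0 = 0" "\<And>z. z \<in> ball 0 R \<Longrightarrow> deriv H z = deriv H 0 * exp (q z)"
    "\<And>z. z \<in> ball 0 R \<Longrightarrow> (q has_field_derivative deriv (deriv H) z / deriv H z) (at z)"
    using holomorphic_log_on_convex[OF holH' open_ball convex_ball _ nz, of 0] R0
    by (metis centre_in_ball)
  define p where "p = (\<lambda>z. deriv (deriv H) z / deriv H z)"
  have holp: "p holomorphic_on ball 0 R"
    unfolding p_def using holH' nz by (intro holomorphic_on_divide holomorphic_deriv[OF holH']) auto
  have p1: "cmod (p \<zeta> - 1) \<le> 32 / R" if \<zeta>: "\<zeta> \<in> cball 0 8" for \<zeta>
  proof -
    have "cmod (p \<zeta> - p 0) \<le> 2 * 2 / R * cmod \<zeta>"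
      using pre nz by (intro holomorphic_dist_center_le[OF holp] in_ball[OF \<zeta>])
        (auto simp: p_def norm_divide divide_le_eq)
    also have "\<dots> \<le> 2 * 2 / R * 8" using \<zeta> R0 by (intro mult_left_mono) auto
    finally show ?thesis by (simp add: p_def norm0)
  qed
  have q1: "cmod (q \<zeta> - \<zeta>) \<le> 256 / R" if \<zeta>: "\<zeta> \<in> cball 0 8" for \<zeta>
  proof -
    have "cmod ((q \<zeta> - \<zeta>) - (q 0 - 0)) \<le> 32 / R * cmod (\<zeta> - 0)"
    proof (rule field_differentiable_bound[where S = "cball 0 8" and f' = "\<lambda>z. p z - 1"])
      show "((\<lambda>z. q z - z) has_field_derivative p z - 1) (at z within cball 0 8)"
        if "z \<in> cball 0 8" for z
        unfolding p_def
        by (auto intro!: derivative_eq_intros has_field_derivative_at_within[OF q(3)[OF in_ball(1)[OF that]]])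
    qed (use \<zeta> p1 in simp_all)
    also have "\<dots> \<le> 32 / R * 8" using \<zeta> R0 by (intro mult_left_mono) auto
    finally show ?thesis by (simp add: q(1))
  qed
  have exp_le: "cmod (exp \<zeta>) \<le> e8" if "\<zeta> \<in> cball 0 8" for \<zeta>
    using norm_exp[of \<zeta>] that unfolding e8_def by (simp add: order_trans)
  have H1: "cmod (deriv H \<zeta> - exp \<zeta>) \<le> 512 * e8 / R"
    and H2: "cmod (deriv H \<zeta>) \<le> 2 * e8" if \<zeta>: "\<zeta> \<in> cball 0 8" for \<zeta>
  proof -
    have le: "256 / R \<le> 1/2" using R' R0 by (simp add: field_simps)
    have "deriv H \<zeta> = exp \<zeta> * exp (q \<zeta> - \<zeta>)"
      using q(2)[OF in_ball(1)[OF \<zeta>]] norm0 by (simp flip: exp_add)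
    then have eq: "deriv H \<zeta> - exp \<zeta> = exp \<zeta> * (exp (q \<zeta> - \<zeta>) - 1)"
      by (simp add: algebra_simps)
    have "cmod (exp (q \<zeta> - \<zeta>) - 1) \<le> 2 * cmod (q \<zeta> - \<zeta>)"
      using q1[OF \<zeta>] le by (intro norm_exp_minus_one_le) linarith
    then have "cmod (exp (q \<zeta> - \<zeta>) - 1) \<le> 512 / R" using q1[OF \<zeta>] by simp
    then have "cmod (deriv H \<zeta> - exp \<zeta>) \<le> e8 * (512 / R)"
      unfolding eq norm_mult using exp_le[OF \<zeta>] e8 by (intro mult_mono) auto
    then show *: "cmod (deriv H \<zeta> - exp \<zeta>) \<le> 512 * e8 / R" by (simp add: mult.commute)
    have "512 * e8 / R \<le> e8" using R' R0 e8 by (simp add: field_simps)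
    then show "cmod (deriv H \<zeta>) \<le> 2 * e8"
      using * exp_le[OF \<zeta>] norm_triangle_ineq[of "exp \<zeta>" "deriv H \<zeta> - exp \<zeta>"] by simp
  qed
  define \<omega> where "\<omega> = (\<lambda>z. deriv G z / deriv H z)"
  have hol\<omega>: "\<omega> holomorphic_on ball 0 R"
    unfolding \<omega>_def using nz by (intro holomorphic_on_divide holG' holH') auto
  have \<omega>k: "cmod (\<omega> \<zeta>) \<le> k" if "\<zeta> \<in> ball 0 R" for \<zeta>
    using dil[OF that] nz[OF that] by (simp add: \<omega>_def norm_divide divide_le_eq)
  define \<omega>0 where "\<omega>0 = \<omega> 0"
  have \<omega>0k: "cmod \<omega>0 \<le> k" using \<omega>k[of 0] R0 by (simp add: \<omega>0_def)
  have G1: "cmod (deriv G \<zeta> - \<omega>0 * exp \<zeta>) \<le> 544 * e8 / R" if \<zeta>: "\<zeta> \<in> cball 0 8" for \<zeta>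
  proof -
    have "cmod (\<omega> \<zeta> - \<omega> 0) \<le> 2 * 1 / R * cmod \<zeta>"
      by (rule holomorphic_dist_center_le[OF hol\<omega> _ in_ball(2)[OF \<zeta>]]) (use \<omega>k k in force)
    also have "\<dots> \<le> 2 * 1 / R * 8" using \<zeta> R0 by (intro mult_left_mono) auto
    finally have o: "cmod (\<omega> \<zeta> - \<omega>0) \<le> 16 / R" by (simp add: \<omega>0_def)
    have "deriv G \<zeta> - \<omega>0 * exp \<zeta> = (\<omega> \<zeta> - \<omega>0) * deriv H \<zeta> + \<omega>0 * (deriv H \<zeta> - exp \<zeta>)"
      using nz[OF in_ball(1)[OF \<zeta>]] by (simp add: \<omega>_def field_simps)
    also have "cmod \<dots> \<le> cmod (\<omega> \<zeta> - \<omega>0) * cmod (deriv H \<zeta>) + cmod \<omega>0 * cmod (deriv H \<zeta> - exp \<zeta>)"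
      by (metis norm_mult norm_triangle_ineq)
    also have "\<dots> \<le> 16 / R * (2 * e8) + 1 * (512 * e8 / R)"
      using o H1[OF \<zeta>] H2[OF \<zeta>] \<omega>0k k R0 by (intro add_mono mult_mono) auto
    finally show ?thesis by (simp add: field_simps)
  qed
  (* N and M are the errors of H - H 0 and G - G 0 against the exponential model *)
  define E where "E = (\<lambda>\<zeta>::complex. exp \<zeta> - 1)"
  define N where "N = (\<lambda>\<zeta>. (H \<zeta> - H 0) - E \<zeta>)"
  define M where "M = (\<lambda>\<zeta>. (G \<zeta> - G 0) - \<omega>0 * E \<zeta>)"
  have Nb: "cmod (N \<zeta> - N 0) \<le> 512 * e8 / R * cmod (\<zeta> - 0)" if \<zeta>: "\<zeta> \<in> cball 0 8" for \<zeta>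
  proof (rule field_differentiable_bound[where S = "cball 0 8" and f' = "\<lambda>z. deriv H z - exp z"])
    show "(N has_field_derivative deriv H z - exp z) (at z within cball 0 8)" if "z \<in> cball 0 8" for z
      unfolding N_def E_def
      by (auto intro!: derivative_eq_intros holomorphic_derivI[OF hol(1) open_ball in_ball(1)[OF that]])
  qed (use \<zeta> H1 in simp_all)
  have Mb: "cmod (M \<zeta> - M 0) \<le> 544 * e8 / R * cmod (\<zeta> - 0)" if \<zeta>: "\<zeta> \<in> cball 0 8" for \<zeta>
  proof (rule field_differentiable_bound[where S = "cball 0 8" and f' = "\<lambda>z. deriv G z - \<omega>0 * exp z"])
    show "(M has_field_derivative deriv G z - \<omega>0 * exp z) (at z within cball 0 8)" if "z \<in> cball 0 8" for z
      unfolding M_def E_def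
      by (auto intro!: derivative_eq_intros holomorphic_derivI[OF hol(2) open_ball in_ball(1)[OF that]])
  qed (use \<zeta> G1 in simp_all)
  have NM: "cmod (N \<zeta>) + cmod (M \<zeta>) \<le> 9000 * e8 / R" if \<zeta>: "\<zeta> \<in> cball 0 8" for \<zeta>
  proof -
    have 1: "cmod (N \<zeta>) \<le> 512 * e8 / R * 8"
    proof -
      have "N 0 = 0" by (simp add: N_def E_def)
      then have "cmod (N \<zeta>) \<le> 512 * e8 / R * cmod \<zeta>" using Nb[OF \<zeta>] by simp
      also have "\<dots> \<le> 512 * e8 / R * 8" using \<zeta> R0 e8 by (intro mult_left_mono) auto
      finally show ?thesis .
    qed
    have 2: "cmod (M \<zeta>) \<le> 544 * e8 / R * 8"
    proof -
      have "M 0 = 0" by (simp add: M_def E_def)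
      then have "cmod (M \<zeta>) \<le> 544 * e8 / R * cmod \<zeta>" using Mb[OF \<zeta>] by simp
      also have "\<dots> \<le> 544 * e8 / R * 8" using \<zeta> R0 e8 by (intro mult_left_mono) auto
      finally show ?thesis .
    qed
    have "512 * e8 / R * 8 + 544 * e8 / R * 8 \<le> 9000 * e8 / R"
      using e8 R0 by (simp add: field_simps)
    then show ?thesis using 1 2 by linarith
  qed
  (* Solving E \<zeta> + cnj (\<omega>0 E \<zeta>) = - err \<zeta> by inverting the real-linear map w + cnj (\<omega>0 w)
     gives E \<zeta> = e \<zeta>. *)
  define err where "err = (\<lambda>\<zeta>. N \<zeta> + cnj (M \<zeta>))"
  define e where "e = (\<lambda>\<zeta>. - (err \<zeta> - cnj \<omega>0 * cnj (err \<zeta>)) / (1 - of_real ((cmod \<omega>0)\<^sup>2)))"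
  have \<omega>1: "(cmod \<omega>0)\<^sup>2 < 1" using \<omega>0k k by (simp add: abs_square_less_1)
  have e_small: "cmod (e \<zeta>) \<le> 1/4" if \<zeta>: "\<zeta> \<in> cball 0 8" for \<zeta>
  proof -
    have err: "cmod (err \<zeta>) \<le> 9000 * e8 / R"
      using NM[OF \<zeta>] norm_triangle_ineq[of "N \<zeta>" "cnj (M \<zeta>)"] by (simp add: err_def)
    have "cmod (err \<zeta> - cnj \<omega>0 * cnj (err \<zeta>)) \<le> cmod (err \<zeta>) * (1 + cmod \<omega>0)"
      using norm_triangle_ineq4[of "err \<zeta>" "cnj \<omega>0 * cnj (err \<zeta>)"] by (simp add: norm_mult algebra_simps)
    moreover have den: "cmod (1 - of_real ((cmod \<omega>0)\<^sup>2)) = (1 - cmod \<omega>0) * (1 + cmod \<omega>0)"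
    proof -
      have "cmod (1 - of_real ((cmod \<omega>0)\<^sup>2)) = \<bar>1 - (cmod \<omega>0)\<^sup>2\<bar>"
        by (metis norm_of_real of_real_1 of_real_diff)
      then show ?thesis using \<omega>1 by (simp add: power2_eq_square algebra_simps)
    qed
    moreover have pos: "0 < 1 - cmod \<omega>0" "0 < 1 + cmod \<omega>0"
      using \<omega>0k k norm_ge_zero[of \<omega>0] by linarith+
    ultimately have "cmod (err \<zeta> - cnj \<omega>0 * cnj (err \<zeta>)) / ((1 - cmod \<omega>0) * (1 + cmod \<omega>0))
        \<le> cmod (err \<zeta>) * (1 + cmod \<omega>0) / ((1 - cmod \<omega>0) * (1 + cmod \<omega>0))"
      by (intro divide_right_mono) auto
    then have "cmod (e \<zeta>) \<le> cmod (err \<zeta>) * (1 + cmod \<omega>0) / ((1 - cmod \<omega>0) * (1 + cmod \<omega>0))"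
      unfolding e_def norm_divide norm_minus_cancel den .
    also have "\<dots> = cmod (err \<zeta>) / (1 - cmod \<omega>0)"
      using pos by (metis less_irrefl nonzero_mult_divide_mult_cancel_right)
    also have "\<dots> \<le> (9000 * e8 / R) / (1 - k)"
      using err \<omega>0k k e8 R0 by (intro frac_le) auto
    also have "\<dots> \<le> 1/4" using Re8 R0 k by (simp add: field_simps)
    finally show ?thesis .
  qed
  have contHG: "continuous_on (cball 0 8) H" "continuous_on (cball 0 8) G"
    by (meson hol holomorphic_on_imp_continuous_on holomorphic_on_subset in_ball(1) subsetI)+
  have nzd: "1 - complex_of_real ((cmod \<omega>0)\<^sup>2) \<noteq> 0"
    using \<omega>1 by (metis eq_iff_diff_eq_0 less_irrefl of_real_1 of_real_eq_iff)
  have conte: "continuous_on (cball 0 8) e"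
    unfolding e_def err_def N_def M_def E_def using nzd
    by (intro continuous_intros contHG) auto
  have pi: "2 * pi + 1 < 8" using pi_approx by simp
  have sub: "cball (2 * of_real pi * \<i>) 1 \<subseteq> cball 0 8"
  proof
    fix x assume "x \<in> cball (2 * of_real pi * \<i>) 1"
    then have "cmod (x - 2 * of_real pi * \<i>) \<le> 1" by (simp add: dist_norm norm_minus_commute)
    moreover have "cmod (2 * of_real pi * \<i>) = 2 * pi" by (simp add: norm_mult)
    ultimately show "x \<in> cball 0 8"
      using norm_triangle_ineq[of "2 * of_real pi * \<i>" "x - 2 * of_real pi * \<i>"] pi by simp
  qed
  (* A fixed point solves exp \<zeta> = 1 + e \<zeta> near 2 pi \<i>. *)
  obtain \<zeta> where \<zeta>: "\<zeta> \<in> cball (2 * of_real pi * \<i>) 1" "2 * of_real pi * \<i> + Ln (1 + e \<zeta>) = \<zeta>"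
  proof (rule brouwer_ball[of 1 "2 * of_real pi * \<i>" "\<lambda>\<zeta>. 2 * of_real pi * \<i> + Ln (1 + e \<zeta>)"])
    show "continuous_on (cball (2 * of_real pi * \<i>) 1) (\<lambda>\<zeta>. 2 * of_real pi * \<i> + Ln (1 + e \<zeta>))"
    proof (intro continuous_intros continuous_on_subset[OF conte sub])
      fix z assume "z \<in> cball (2 * of_real pi * \<i>) 1"
      then have "cmod (e z) \<le> 1/4" using e_small sub by blast
      then have "Re (1 + e z) > 0" using abs_Re_le_cmod[of "e z"] by simp
      then show "1 + e z \<notin> \<real>\<^sub>\<le>\<^sub>0" using complex_nonpos_Reals_iff by force
    qed
    show "(\<lambda>\<zeta>. 2 * of_real pi * \<i> + Ln (1 + e \<zeta>))
            \<in> cball (2 * of_real pi * \<i>) 1 \<rightarrow> cball (2 * of_real pi * \<i>) 1"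
    proof
      fix z assume "z \<in> cball (2 * of_real pi * \<i>) 1"
      then have "cmod (e z) \<le> 1/4" using e_small sub by blast
      then have "cmod (Ln (1 + e z)) \<le> 1" using norm_Ln_le[of "e z"] by simp
      then show "2 * of_real pi * \<i> + Ln (1 + e z) \<in> cball (2 * of_real pi * \<i>) 1"
        by (simp add: dist_norm)
    qed
  qed auto
  have \<zeta>8: "\<zeta> \<in> cball 0 8" using \<zeta> sub by blast
  have "cmod (e \<zeta>) < 1" using e_small[OF \<zeta>8] by simp
  then have "1 + e \<zeta> \<noteq> 0"
    by (metis add_eq_0_iff norm_minus_cancel norm_one less_irrefl)
  then have "exp \<zeta> = 1 + e \<zeta>"
    using arg_cong[OF \<zeta>(2), of exp] by (simp add: exp_add)
  then have Ee: "E \<zeta> = e \<zeta>" by (simp add: E_def)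
  have A: "e \<zeta> + cnj (\<omega>0 * e \<zeta>) = - err \<zeta>"
  proof -
    define D where "D = 1 - complex_of_real ((cmod \<omega>0)\<^sup>2)"
    have D: "D \<noteq> 0" "D = 1 - \<omega>0 * cnj \<omega>0" "cnj D = D"
      using nzd unfolding D_def by (simp_all only: complex_norm_square complex_cnj_diff complex_cnj_one complex_cnj_mult complex_cnj_cnj mult.commute) simp_all
    have eD: "e \<zeta> * D = - (err \<zeta> - cnj \<omega>0 * cnj (err \<zeta>))"
      unfolding e_def D_def[symmetric] using D(1) by simp
    from arg_cong[OF this, of cnj]
    have "cnj (e \<zeta>) * D = - (cnj (err \<zeta>) - \<omega>0 * err \<zeta>)"
      using D(3) by simp
    with eD have "(e \<zeta> + cnj (\<omega>0 * e \<zeta>)) * D = - err \<zeta> * (1 - \<omega>0 * cnj \<omega>0)"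
      by (simp add: distrib_right mult.assoc) (simp add: algebra_simps)
    then show ?thesis using D(1) unfolding D(2) by (simp only: mult_cancel_right) auto
  qed
  have "H \<zeta> + cnj (G \<zeta>) - (H 0 + cnj (G 0)) = (E \<zeta> + cnj (\<omega>0 * E \<zeta>)) + err \<zeta>"
    by (simp add: err_def N_def M_def)
  also have "\<dots> = 0" using A Ee by simp
  finally have "H \<zeta> + cnj (G \<zeta>) = H 0 + cnj (G 0)" by simp
  then have "\<zeta> = 0"
    using inj in_ball(1)[OF \<zeta>8] R0 by (auto dest: inj_onD)
  then have "cmod (2 * of_real pi * \<i>) \<le> 1" using \<zeta>(1) by simp
  then show False using pi_gt3 by (simp add: norm_mult)
qed

section \<open>Distortion of injective harmonic quasiconformal maps\<close>

text \<open>The topological notion of orientation has been replaced by the conditions \<open>h' \<noteq> 0\<close> and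
  \<open>\<bar>g'\<bar> \<le> k \<bar>h'\<bar>\<close> with \<open>k < 1\<close>, which make the Jacobian of \<open>f\<close> positive.\<close>

locale harmonic_qc_disk =
  fixes f h g :: "complex \<Rightarrow> complex" and k :: real
  assumes hol_h: "h holomorphic_on ball 0 1" and hol_g: "g holomorphic_on ball 0 1"
    and f_eq: "\<And>z. z \<in> ball 0 1 \<Longrightarrow> f z = h z + cnj (g z)"
    and k_nonneg: "0 \<le> k" and k_less_1: "k < 1"
    and dil: "\<And>z. z \<in> ball 0 1 \<Longrightarrow> cmod (deriv g z) \<le> k * cmod (deriv h z)"
    and h'_nz: "\<And>z. z \<in> ball 0 1 \<Longrightarrow> deriv h z \<noteq> 0"
    and inj_f: "inj_on f (ball 0 1)"

begin

lemma hol_h': "deriv h holomorphic_on ball 0 1"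
  using hol_h by (intro holomorphic_deriv) auto

lemma deriv_h: "z \<in> ball 0 1 \<Longrightarrow> (h has_field_derivative deriv h z) (at z within T)"
  and deriv_g: "z \<in> ball 0 1 \<Longrightarrow> (g has_field_derivative deriv g z) (at z within T)"
  and deriv_h': "z \<in> ball 0 1 \<Longrightarrow> (deriv h has_field_derivative deriv (deriv h) z) (at z within T)"
  using hol_h hol_g hol_h' by (auto intro!: holomorphic_derivI)

lemmas continuous_f = continuous_on_harmonic[OF hol_h hol_g f_eq]

lemma has_derivative_f:
  "z \<in> ball 0 1 \<Longrightarrow> (f has_derivative (\<lambda>v. deriv h z * v + cnj (deriv g z * v))) (at z)"
  by (rule has_derivative_harmonic[OF open_ball hol_h hol_g f_eq])

lemma open_image_f: "open (f ` ball 0 1)"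
  using invariance_of_domain[OF continuous_f _ inj_f] by simp

lemma norm_D_eq: "z \<in> ball 0 1 \<Longrightarrow> norm_D f z = cmod (deriv h z) + cmod (deriv g z)"
  using harmonic_wirtinger_derivs[OF has_derivative_f] by (simp add: norm_D_def)

lemma norm_D_bounds:
  assumes "z \<in> ball 0 1"
  shows "cmod (deriv h z) \<le> norm_D f z" "norm_D f z \<le> 2 * cmod (deriv h z)"
proof -
  have "cmod (deriv g z) \<le> k * cmod (deriv h z)" by (rule dil[OF assms])
  also have "\<dots> \<le> 1 * cmod (deriv h z)" using k_less_1 by (intro mult_right_mono) auto
  finally show "cmod (deriv h z) \<le> norm_D f z" "norm_D f z \<le> 2 * cmod (deriv h z)"
    using norm_D_eq[OF assms] by auto
qed

text \<open>Suppose the quantity is large somewhere. Replace \<open>1 - \<bar>z\<bar>\<close> by \<open>r - \<bar>z\<bar>\<close> with \<open>r < 1\<close>, so that a maximum point \<open>z1\<close>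
  exists, and rescale around \<open>z1\<close> by the factor \<open>a = h'(z1) / h''(z1)\<close>. By maximality the rescaled
  pre-Schwarzian derivative is at most 2 on a disk of radius \<open>R\<close>, and it equals 1 at the centre: the situation
  excluded by \<open>almost_exponential_not_inj\<close>.\<close>

lemma pre_schwarzian_bound:
  "\<exists>C>0. \<forall>z\<in>ball 0 1. (1 - cmod z) * cmod (deriv (deriv h) z) \<le> C * cmod (deriv h z)"
proof -
  define R where "R = 36000 * exp 8 / (1 - k)"
  have R0: "R > 0" using k_less_1 by (simp add: R_def)
  define P where "P = (\<lambda>z. deriv (deriv h) z / deriv h z)"
  have contP: "continuous_on (ball 0 1) P"
    unfolding P_def using h'_nz
    by (intro continuous_intros holomorphic_on_imp_continuous_on hol_h' holomorphic_deriv[OF hol_h']) auto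
  have "(1 - cmod z) * cmod (P z) \<le> 2 * R" if z: "z \<in> ball 0 1" for z
  proof (rule ccontr)
    assume "\<not> ?thesis"
    then have big: "2 * R < (1 - cmod z) * cmod (P z)" by simp
    have Pz: "cmod (P z) > 0" using big R0 by (smt (verit) mult_nonneg_nonpos norm_ge_zero mult_eq_0_iff)
    then have "2 * R / cmod (P z) < 1 - cmod z" using big by (simp add: divide_less_eq)
    then obtain s where s: "2 * R / cmod (P z) < s" "s < 1 - cmod z" using dense by blast
    define r where "r = cmod z + s"
    have "0 < 2 * R / cmod (P z)" using Pz R0 by simp
    then have s0: "0 < s" "0 < cmod z + s" using s norm_ge_zero[of z] by linarith+
    have r: "r < 1" "cmod z < r" "0 < r" "2 * R < (r - cmod z) * cmod (P z)"
      using s Pz norm_ge_zero[of z] s0 by (simp_all add: r_def divide_less_eq)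
    define \<phi> where "\<phi> = (\<lambda>z. (r - cmod z) * cmod (P z))"
    have "continuous_on (cball 0 r) \<phi>"
      unfolding \<phi>_def using r by (intro continuous_intros continuous_on_subset[OF contP]) auto
    moreover have "cball (0::complex) r \<noteq> {}" using r by auto
    ultimately obtain z1 where z1: "z1 \<in> cball 0 r" "\<And>y. y \<in> cball 0 r \<Longrightarrow> \<phi> y \<le> \<phi> z1"
      using continuous_attains_sup[OF compact_cball] by metis
    have \<phi>1: "2 * R < \<phi> z1" using z1(2)[of z] r by (simp add: \<phi>_def)
    have "r - cmod z1 > 0" and P1: "P z1 \<noteq> 0"
      using \<phi>1 R0 z1(1) by (auto simp: \<phi>_def zero_less_mult_iff less_eq_real_def)
    have z1D: "z1 \<in> ball 0 1" using z1(1) r by auto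
    define a where "a = 1 / P z1"
    define c where "c = deriv h z1"
    have a0: "a \<noteq> 0" and c0: "c \<noteq> 0" using P1 h'_nz[OF z1D] by (auto simp: a_def c_def)
    have gap: "2 * (R * cmod a) < r - cmod z1"
      using \<phi>1 P1 by (simp add: \<phi>_def a_def norm_divide field_simps)
    have close: "cmod (z1 + a * \<zeta>) < r - R * cmod a" if "\<zeta> \<in> ball 0 R" for \<zeta>
    proof -
      have "cmod (z1 + a * \<zeta>) \<le> cmod z1 + cmod a * cmod \<zeta>" by (metis norm_mult norm_triangle_ineq)
      also have "\<dots> \<le> cmod z1 + cmod a * R" using that by (intro add_left_mono mult_left_mono) auto
      also have "\<dots> = cmod z1 + R * cmod a" by simp
      finally show ?thesis using gap by linarith
    qed
    have mapD: "z1 + a * \<zeta> \<in> ball 0 1" if "\<zeta> \<in> ball 0 R" for \<zeta>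
    proof -
      have "0 \<le> R * cmod a" using R0 by simp
      then show ?thesis using close[OF that] r by simp
    qed
    have P2: "cmod (a * P (z1 + a * \<zeta>)) \<le> 2" if \<zeta>: "\<zeta> \<in> ball 0 R" for \<zeta>
    proof -
      have Ra: "0 \<le> R * cmod a" using R0 by simp
      have "(r - cmod (z1 + a * \<zeta>)) * cmod (P (z1 + a * \<zeta>)) \<le> (r - cmod z1) * cmod (P z1)"
        using z1(2)[of "z1 + a * \<zeta>"] close[OF \<zeta>] Ra by (simp add: \<phi>_def)
      moreover have "(r - cmod z1) / 2 \<le> r - cmod (z1 + a * \<zeta>)"
      proof -
        have "cmod (z1 + a * \<zeta>) \<le> cmod z1 + cmod a * cmod \<zeta>" by (metis norm_mult norm_triangle_ineq)
        also have "\<dots> \<le> cmod z1 + cmod a * R" using \<zeta> by (intro add_left_mono mult_left_mono) auto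
        also have "\<dots> = cmod z1 + R * cmod a" by simp
        finally have "r - cmod z1 \<le> 2 * (r - cmod (z1 + a * \<zeta>))" using gap by (simp add: algebra_simps)
        then show ?thesis by simp
      qed
      ultimately have "(r - cmod z1) / 2 * cmod (P (z1 + a * \<zeta>)) \<le> (r - cmod z1) * cmod (P z1)"
        by (meson mult_right_mono norm_ge_zero order_trans)
      then have "(r - cmod z1) * cmod (P (z1 + a * \<zeta>)) \<le> (r - cmod z1) * (2 * cmod (P z1))"
        by linarith
      then have "cmod (P (z1 + a * \<zeta>)) \<le> 2 * cmod (P z1)"
        using \<open>r - cmod z1 > 0\<close> mult_le_cancel_left_pos by blast
      then show ?thesis using P1 by (simp add: a_def norm_mult norm_divide divide_le_eq)
    qed
    define H where "H = (\<lambda>\<zeta>. h (z1 + a * \<zeta>) / (a * c))"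
    define G where "G = (\<lambda>\<zeta>. g (z1 + a * \<zeta>) / cnj (a * c))"
    have inner: "((\<lambda>\<zeta>. z1 + a * \<zeta>) has_field_derivative a) (at \<zeta>)" for \<zeta>
      by (auto intro!: derivative_eq_intros)
    have dH: "(H has_field_derivative deriv h (z1 + a * \<zeta>) / c) (at \<zeta>)" if "\<zeta> \<in> ball 0 R" for \<zeta>
    proof -
      have "((\<lambda>\<zeta>. h (z1 + a * \<zeta>)) has_field_derivative deriv h (z1 + a * \<zeta>) * a) (at \<zeta>)"
        by (rule DERIV_chain2[OF _ inner]) (rule deriv_h[OF mapD[OF that]])
      from DERIV_cdivide[OF this, of "a * c"] show ?thesis using a0 by (simp add: H_def)
    qed
    have dG: "(G has_field_derivative deriv g (z1 + a * \<zeta>) * a / cnj (a * c)) (at \<zeta>)" if "\<zeta> \<in> ball 0 R" for \<zeta>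
    proof -
      have "((\<lambda>\<zeta>. g (z1 + a * \<zeta>)) has_field_derivative deriv g (z1 + a * \<zeta>) * a) (at \<zeta>)"
        by (rule DERIV_chain2[OF _ inner]) (rule deriv_g[OF mapD[OF that]])
      from DERIV_cdivide[OF this, of "cnj (a * c)"] show ?thesis by (simp add: G_def)
    qed
    have dH': "(deriv H has_field_derivative a * deriv (deriv h) (z1 + a * \<zeta>) / c) (at \<zeta>)" if "\<zeta> \<in> ball 0 R" for \<zeta>
    proof (rule has_field_derivative_transform_within_open[OF _ open_ball that])
      have "((\<lambda>\<zeta>. deriv h (z1 + a * \<zeta>)) has_field_derivative deriv (deriv h) (z1 + a * \<zeta>) * a) (at \<zeta>)"
        by (rule DERIV_chain2[OF _ inner]) (rule deriv_h'[OF mapD[OF that]])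
      from DERIV_cdivide[OF this, of c]
      show "((\<lambda>\<zeta>. deriv h (z1 + a * \<zeta>) / c) has_field_derivative a * deriv (deriv h) (z1 + a * \<zeta>) / c) (at \<zeta>)"
        by (simp add: mult.commute)
      show "deriv h (z1 + a * x) / c = deriv H x" if "x \<in> ball 0 R" for x
        using DERIV_imp_deriv[OF dH[OF that]] by simp
    qed
    have "\<not> inj_on (\<lambda>\<zeta>. H \<zeta> + cnj (G \<zeta>)) (ball 0 R)"
    proof (rule almost_exponential_not_inj[OF k_nonneg k_less_1])
      show "36000 * exp 8 / (1 - k) \<le> R" by (simp add: R_def)
      show "H holomorphic_on ball 0 R" "G holomorphic_on ball 0 R"
        using dH dG unfolding holomorphic_on_open[OF open_ball] by blast+
      show "deriv H 0 = 1" using DERIV_imp_deriv[OF dH[of 0]] R0 c0 by (simp add: c_def)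
      show "deriv (deriv H) 0 = 1"
        using DERIV_imp_deriv[OF dH'[of 0]] R0 c0 P1 by (simp add: c_def a_def P_def)
    next
      fix \<zeta> :: complex assume \<zeta>: "\<zeta> \<in> ball 0 R"
      note eqs = DERIV_imp_deriv[OF dH[OF \<zeta>]] DERIV_imp_deriv[OF dH'[OF \<zeta>]] DERIV_imp_deriv[OF dG[OF \<zeta>]]
      show "deriv H \<zeta> \<noteq> 0" using eqs h'_nz[OF mapD[OF \<zeta>]] c0 by simp
      show "cmod (deriv G \<zeta>) \<le> k * cmod (deriv H \<zeta>)"
        using eqs dil[OF mapD[OF \<zeta>]] a0 c0 by (simp add: norm_mult norm_divide divide_right_mono)
      have "cmod (a * deriv (deriv h) (z1 + a * \<zeta>)) \<le> 2 * cmod (deriv h (z1 + a * \<zeta>))"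
        using P2[OF \<zeta>] h'_nz[OF mapD[OF \<zeta>]] by (simp add: P_def norm_mult norm_divide field_simps)
      then show "cmod (deriv (deriv H) \<zeta>) \<le> 2 * cmod (deriv H \<zeta>)"
        using eqs c0 by (simp add: norm_divide divide_right_mono)
    qed
    moreover have "inj_on (\<lambda>\<zeta>. H \<zeta> + cnj (G \<zeta>)) (ball 0 R)"
    proof (rule inj_onI)
      fix x y :: complex assume x: "x \<in> ball 0 R" and y: "y \<in> ball 0 R" and "H x + cnj (G x) = H y + cnj (G y)"
      moreover have "H t + cnj (G t) = f (z1 + a * t) / (a * c)" if "t \<in> ball 0 R" for t
        using f_eq[OF mapD[OF that]] by (simp add: H_def G_def add_divide_distrib)
      ultimately have "f (z1 + a * x) = f (z1 + a * y)" using a0 c0 by simp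
      then have "z1 + a * x = z1 + a * y" using inj_onD[OF inj_f] mapD[OF x] mapD[OF y] by blast
      then show "x = y" using a0 by simp
    qed
    ultimately show False by blast
  qed
  then have "(1 - cmod z) * cmod (deriv (deriv h) z) \<le> (2 * R) * cmod (deriv h z)" if "z \<in> ball 0 1" for z
    using that h'_nz[OF that] by (simp add: P_def norm_divide divide_le_eq)
  then show ?thesis using R0 by (intro exI[of _ "2 * R"]) auto
qed

lemma log_h':
  obtains q where "\<And>z. z \<in> ball 0 1 \<Longrightarrow> deriv h z = deriv h 0 * exp (q z)"
    "\<And>z. z \<in> ball 0 1 \<Longrightarrow> (q has_field_derivative deriv (deriv h) z / deriv h z) (at z)"
  using holomorphic_log_on_convex[OF hol_h' open_ball convex_ball _ h'_nz, of 0]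
  by (metis centre_in_ball zero_less_one)

lemma norm_deriv_h_le_exp:
  assumes "\<And>z. z \<in> ball 0 1 \<Longrightarrow> deriv h z = deriv h 0 * exp (q z)"
    and "x \<in> ball 0 1" "y \<in> ball 0 1" "cmod (q x - q y) \<le> M"
  shows "cmod (deriv h x) \<le> exp M * cmod (deriv h y)"
proof -
  have "deriv h x = exp (q x - q y) * deriv h y"
    using assms(1)[OF assms(2)] assms(1)[OF assms(3)] by (simp add: exp_diff)
  moreover have "cmod (exp (q x - q y)) \<le> exp M"
    using norm_exp[of "q x - q y"] assms(4) by (meson exp_le_cancel_iff order_trans)
  ultimately show ?thesis by (simp only: norm_mult mult_right_mono norm_ge_zero)
qed

text \<open>Integrating \<open>h''/h'\<close> along paths of bounded hyperbolic length. Both kinds of paths used below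
  are covered: segments inside a disk about \<open>z\<close> of half the distance to the unit circle, and circular arcs of
  the angular size that occurs in the boxes \<open>B(z)\<close>.\<close>

lemma harnack:
  "\<exists>L\<ge>1. (\<forall>z\<in>ball 0 1. \<forall>\<zeta>\<in>cball z ((1 - cmod z) / 2).
              cmod (deriv h \<zeta>) \<le> L * cmod (deriv h z) \<and> cmod (deriv h z) \<le> L * cmod (deriv h \<zeta>)) \<and>
          (\<forall>r \<alpha> \<beta>. 0 \<le> r \<and> r < 1 \<and> \<bar>\<alpha> - \<beta>\<bar> \<le> pi * (1 - r) \<longrightarrow>
              cmod (deriv h (rcis r \<alpha>)) \<le> L * cmod (deriv h (rcis r \<beta>)))"
proof -
  obtain C where C: "C > 0"
    "\<And>z. z \<in> ball 0 1 \<Longrightarrow> (1 - cmod z) * cmod (deriv (deriv h) z) \<le> C * cmod (deriv h z)"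
    using pre_schwarzian_bound by blast
  obtain q where q: "\<And>z. z \<in> ball 0 1 \<Longrightarrow> deriv h z = deriv h 0 * exp (q z)"
    "\<And>z. z \<in> ball 0 1 \<Longrightarrow> (q has_field_derivative deriv (deriv h) z / deriv h z) (at z)"
    by (rule log_h') blast
  have q': "cmod (deriv (deriv h) z / deriv h z) \<le> C / (1 - cmod z)" if "z \<in> ball 0 1" for z
    using C(2)[OF that] h'_nz[OF that] that by (simp add: norm_divide field_simps)
  define L where "L = exp (C * pi)"
  have L1: "L \<ge> 1" using C by (simp add: L_def)
  have CL: "exp C \<le> L" using C pi_gt3 by (simp add: L_def)
  have near: "cmod (deriv h x) \<le> L * cmod (deriv h y)"
    if z: "z \<in> ball 0 1" and xy: "x \<in> cball z ((1 - cmod z) / 2)" "y \<in> cball z ((1 - cmod z) / 2)"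
      "cmod (x - y) \<le> (1 - cmod z) / 2" for x y z
  proof -
    have in_D: "\<zeta> \<in> ball 0 1" "(1 - cmod z) / 2 \<le> 1 - cmod \<zeta>" if "\<zeta> \<in> cball z ((1 - cmod z) / 2)" for \<zeta>
    proof -
      have "cmod \<zeta> \<le> cmod z + cmod (\<zeta> - z)" by (rule norm_triangle_sub)
      moreover have "cmod (\<zeta> - z) \<le> (1 - cmod z) / 2"
        using that by (simp add: dist_norm norm_minus_commute)
      ultimately have "cmod \<zeta> \<le> cmod z + (1 - cmod z) / 2" by linarith
      then show "(1 - cmod z) / 2 \<le> 1 - cmod \<zeta>" "\<zeta> \<in> ball 0 1" using z by (auto simp: field_simps)
    qed
    have "cmod (q x - q y) \<le> 2 * C / (1 - cmod z) * cmod (x - y)"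
    proof (rule field_differentiable_bound[OF convex_cball])
      fix \<zeta> assume \<zeta>: "\<zeta> \<in> cball z ((1 - cmod z) / 2)"
      show "(q has_field_derivative deriv (deriv h) \<zeta> / deriv h \<zeta>) (at \<zeta> within cball z ((1 - cmod z) / 2))"
        by (rule has_field_derivative_at_within[OF q(2)[OF in_D(1)[OF \<zeta>]]])
      have "C / (1 - cmod \<zeta>) \<le> C / ((1 - cmod z) / 2)"
        using C z in_D[OF \<zeta>] by (intro divide_left_mono) auto
      then show "cmod (deriv (deriv h) \<zeta> / deriv h \<zeta>) \<le> 2 * C / (1 - cmod z)"
        using q'[OF in_D(1)[OF \<zeta>]] by (simp add: mult.commute)
    qed (use xy in auto)
    also have "\<dots> \<le> 2 * C / (1 - cmod z) * ((1 - cmod z) / 2)"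
      using xy C z by (intro mult_left_mono) auto
    also have "\<dots> = C" using z by auto
    finally have "cmod (deriv h x) \<le> exp C * cmod (deriv h y)"
      using norm_deriv_h_le_exp[OF q(1)] in_D xy by blast
    also have "\<dots> \<le> L * cmod (deriv h y)" using CL by (intro mult_right_mono) auto
    finally show ?thesis .
  qed
  have arc: "cmod (deriv h (rcis r \<alpha>)) \<le> L * cmod (deriv h (rcis r \<beta>))"
    if r: "0 \<le> r" "r < 1" "\<bar>\<alpha> - \<beta>\<bar> \<le> pi * (1 - r)" for r \<alpha> \<beta>
  proof -
    define S where "S = closed_segment (complex_of_real \<beta>) (of_real \<alpha>)"
    define e where "e = (\<lambda>w::complex. of_real r * exp (\<i> * w))"
    have e: "e (of_real t) = rcis r t" for t by (simp add: e_def rcis_def cis_conv_exp)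
    have eS: "e w \<in> ball 0 1" "cmod (e w) = r" if "w \<in> S" for w
    proof -
      have "w \<in> of_real ` closed_segment \<beta> \<alpha>"
        using that unfolding S_def closed_segment_of_real .
      then obtain t where "w = of_real t" by blast
      then show "e w \<in> ball 0 1" "cmod (e w) = r" using r by (simp_all add: e)
    qed
    have "cmod (q (e (of_real \<alpha>)) - q (e (of_real \<beta>))) \<le> C / (1 - r) * cmod (complex_of_real \<alpha> - of_real \<beta>)"
    proof (rule field_differentiable_bound[where S = S and
          f' = "\<lambda>w. deriv (deriv h) (e w) / deriv h (e w) * (\<i> * e w)"])
      fix w assume w: "w \<in> S"
      have "(e has_field_derivative \<i> * e w) (at w)"
        unfolding e_def by (auto intro!: derivative_eq_intros)
      from DERIV_chain2[OF q(2)[OF eS(1)[OF w]] this]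
      show "((\<lambda>w. q (e w)) has_field_derivative deriv (deriv h) (e w) / deriv h (e w) * (\<i> * e w)) (at w within S)"
        by (rule has_field_derivative_at_within)
      have "cmod (deriv (deriv h) (e w) / deriv h (e w)) * cmod (\<i> * e w) \<le> C / (1 - r) * 1"
        using q'[OF eS(1)[OF w]] r C eS(2)[OF w] by (intro mult_mono) (auto simp: norm_mult)
      then show "cmod (deriv (deriv h) (e w) / deriv h (e w) * (\<i> * e w)) \<le> C / (1 - r)"
        by (simp only: norm_mult mult_1_right)
    qed (auto simp: S_def)
    also have "cmod (complex_of_real \<alpha> - of_real \<beta>) = \<bar>\<alpha> - \<beta>\<bar>"
      by (metis norm_of_real of_real_diff)
    also have "C / (1 - r) * \<bar>\<alpha> - \<beta>\<bar> \<le> C / (1 - r) * (pi * (1 - r))"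
      using r C by (intro mult_left_mono) auto
    also have "\<dots> = C * pi" using r by simp
    finally have *: "cmod (q (rcis r \<alpha>) - q (rcis r \<beta>)) \<le> C * pi" by (simp add: e)
    show ?thesis
      unfolding L_def using r by (intro norm_deriv_h_le_exp[OF q(1) _ _ *]) auto
  qed
  show ?thesis
  proof (intro exI[of _ L] conjI L1 ballI allI impI)
    fix z \<zeta> assume "z \<in> ball (0::complex) 1" "\<zeta> \<in> cball z ((1 - cmod z) / 2)"
    then show "cmod (deriv h \<zeta>) \<le> L * cmod (deriv h z)" "cmod (deriv h z) \<le> L * cmod (deriv h \<zeta>)"
      using near[of z \<zeta> z] near[of z z \<zeta>] by (auto simp: dist_norm norm_minus_commute)
  qed (use arc in blast)
qed

text \<open>The image of an arc of a box is no longer than a multiple of \<open>\<lambda>\<close>, since \<open>\<bar>h'\<bar>\<close> is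
  essentially constant on the arc.\<close>

lemma arc_image_bound:
  "\<exists>c>0. \<forall>r \<alpha> \<beta>. 0 \<le> r \<and> r < 1 \<and> \<bar>\<alpha> - \<beta>\<bar> \<le> pi * (1 - r) \<longrightarrow>
     cmod (f (rcis r \<alpha>) - f (rcis r \<beta>)) \<le> c * ((1 - r) * cmod (deriv h (rcis r \<beta>)))"
proof -
  obtain L where L: "L \<ge> 1" "\<And>r \<alpha> \<beta>. 0 \<le> r \<Longrightarrow> r < 1 \<Longrightarrow> \<bar>\<alpha> - \<beta>\<bar> \<le> pi * (1 - r) \<Longrightarrow>
              cmod (deriv h (rcis r \<alpha>)) \<le> L * cmod (deriv h (rcis r \<beta>))"
    using harnack by blast
  have "cmod (f (rcis r \<alpha>) - f (rcis r \<beta>)) \<le> 2 * L * pi * ((1 - r) * cmod (deriv h (rcis r \<beta>)))"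
    if r: "0 \<le> r" "r < 1" "\<bar>\<alpha> - \<beta>\<bar> \<le> pi * (1 - r)" for r \<alpha> \<beta>
  proof -
    define S where "S = closed_segment (complex_of_real \<beta>) (of_real \<alpha>)"
    define e where "e = (\<lambda>w::complex. of_real r * exp (\<i> * w))"
    define B where "B = L * cmod (deriv h (rcis r \<beta>))"
    have e: "e (of_real t) = rcis r t" for t by (simp add: e_def rcis_def cis_conv_exp)
    have eS: "e w \<in> ball 0 1" "cmod (\<i> * e w) \<le> 1" "cmod (deriv h (e w)) \<le> B" if "w \<in> S" for w
    proof -
      have "w \<in> of_real ` closed_segment \<beta> \<alpha>"
        using that unfolding S_def closed_segment_of_real .
      then obtain t where t: "w = of_real t" "t \<in> closed_segment \<beta> \<alpha>" by blast
      then have "\<bar>t - \<beta>\<bar> \<le> \<bar>\<alpha> - \<beta>\<bar>" by (auto simp: closed_segment_eq_real_ivl split: if_splits)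
      then show "cmod (deriv h (e w)) \<le> B"
        unfolding B_def t(1) e using r by (intro L(2)) auto
      show "e w \<in> ball 0 1" "cmod (\<i> * e w) \<le> 1" using r t by (simp_all add: e norm_mult)
    qed
    have de: "(e has_field_derivative \<i> * e w) (at w)" for w
      unfolding e_def by (auto intro!: derivative_eq_intros)
    have B0: "B \<ge> 0" using L by (simp add: B_def)
    have hB: "cmod (h (e (of_real \<alpha>)) - h (e (of_real \<beta>))) \<le> B * cmod (complex_of_real \<alpha> - of_real \<beta>)"
    proof (rule field_differentiable_bound[where S = S and f' = "\<lambda>w. deriv h (e w) * (\<i> * e w)"])
      fix w assume w: "w \<in> S"
      from DERIV_chain2[OF deriv_h[OF eS(1)[OF w]] de]
      show "((\<lambda>w. h (e w)) has_field_derivative deriv h (e w) * (\<i> * e w)) (at w within S)"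
        by (rule has_field_derivative_at_within)
      have "cmod (deriv h (e w)) * cmod (\<i> * e w) \<le> B * 1"
        using eS[OF w] B0 by (intro mult_mono) auto
      then show "cmod (deriv h (e w) * (\<i> * e w)) \<le> B" by (simp only: norm_mult mult_1_right)
    qed (auto simp: S_def)
    have gB: "cmod (g (e (of_real \<alpha>)) - g (e (of_real \<beta>))) \<le> B * cmod (complex_of_real \<alpha> - of_real \<beta>)"
    proof (rule field_differentiable_bound[where S = S and f' = "\<lambda>w. deriv g (e w) * (\<i> * e w)"])
      fix w assume w: "w \<in> S"
      from DERIV_chain2[OF deriv_g[OF eS(1)[OF w]] de]
      show "((\<lambda>w. g (e w)) has_field_derivative deriv g (e w) * (\<i> * e w)) (at w within S)"
        by (rule has_field_derivative_at_within)
      have "cmod (deriv g (e w)) \<le> 1 * cmod (deriv h (e w))"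
        using dil[OF eS(1)[OF w]] k_less_1 by (meson mult_right_mono norm_ge_zero order_trans less_imp_le)
      then have "cmod (deriv g (e w)) * cmod (\<i> * e w) \<le> B * 1"
        using eS[OF w] B0 by (intro mult_mono) auto
      then show "cmod (deriv g (e w) * (\<i> * e w)) \<le> B" by (simp only: norm_mult mult_1_right)
    qed (auto simp: S_def)
    have "f (rcis r \<alpha>) - f (rcis r \<beta>) = (h (rcis r \<alpha>) - h (rcis r \<beta>)) + cnj (g (rcis r \<alpha>) - g (rcis r \<beta>))"
      using f_eq[of "rcis r \<alpha>"] f_eq[of "rcis r \<beta>"] r by simp
    also have "cmod \<dots> \<le> B * cmod (complex_of_real \<alpha> - of_real \<beta>) + B * cmod (complex_of_real \<alpha> - of_real \<beta>)"
      using hB gB unfolding e by (intro norm_triangle_le add_mono) (simp_all only: complex_mod_cnj)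
    also have "cmod (complex_of_real \<alpha> - of_real \<beta>) = \<bar>\<alpha> - \<beta>\<bar>"
      by (metis norm_of_real of_real_diff)
    also have "B * \<bar>\<alpha> - \<beta>\<bar> + B * \<bar>\<alpha> - \<beta>\<bar> \<le> B * (pi * (1 - r)) + B * (pi * (1 - r))"
      using r B0 by (intro add_mono mult_left_mono) auto
    finally show ?thesis by (simp add: B_def mult_ac)
  qed
  then show ?thesis using L pi_gt_zero by (intro exI[of _ "2 * L * pi"]) auto
qed

text \<open>The bound for \<open>h''/h'\<close> is scale invariant, so one \<open>\<epsilon>\<close> serves for all \<open>z\<close>. The bound \<open>1/4\<close> makes
  disks of radius \<open>\<epsilon> (1 - \<bar>z\<bar>)\<close> about points with successively halved distances to the unit circle disjoint.\<close>

lemma deriv_h_near: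
  assumes \<eta>: "\<eta> > 0"
  shows "\<exists>\<epsilon>>0. \<epsilon> \<le> 1/4 \<and> (\<forall>z\<in>ball 0 1. \<forall>\<zeta>\<in>cball z (\<epsilon> * (1 - cmod z)).
           cmod (deriv h \<zeta> - deriv h z) \<le> \<eta> * cmod (deriv h z))"
proof -
  obtain C where C: "C > 0"
    "\<And>z. z \<in> ball 0 1 \<Longrightarrow> (1 - cmod z) * cmod (deriv (deriv h) z) \<le> C * cmod (deriv h z)"
    using pre_schwarzian_bound by blast
  obtain L where L: "L \<ge> 1"
    "\<And>z \<zeta>. z \<in> ball 0 1 \<Longrightarrow> \<zeta> \<in> cball z ((1 - cmod z) / 2) \<Longrightarrow> cmod (deriv h \<zeta>) \<le> L * cmod (deriv h z)"
    using harnack by blast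
  define \<epsilon> where "\<epsilon> = min (1/4) (\<eta> / (2 * C * L))"
  have \<epsilon>: "\<epsilon> > 0" "\<epsilon> \<le> 1/4" "\<epsilon> \<le> \<eta> / (2 * C * L)" using \<eta> C L by (auto simp: \<epsilon>_def)
  have \<epsilon>': "2 * C * L * \<epsilon> \<le> \<eta>" using \<epsilon>(3) C L by (simp add: field_simps)
  have "cmod (deriv h \<zeta> - deriv h z) \<le> \<eta> * cmod (deriv h z)"
    if z: "z \<in> ball 0 1" and \<zeta>: "\<zeta> \<in> cball z (\<epsilon> * (1 - cmod z))" for z \<zeta>
  proof -
    define m where "m = 1 - cmod z"
    have m: "m > 0" using z by (simp add: m_def)
    have in_D: "x \<in> ball 0 1" "m / 2 \<le> 1 - cmod x" "x \<in> cball z (m / 2)" if "x \<in> cball z (\<epsilon> * m)" for x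
    proof -
      have "\<epsilon> * m \<le> 1/2 * m" using \<epsilon> m by (intro mult_right_mono) auto
      then show xz: "x \<in> cball z (m / 2)" using that by auto
      have "cmod x \<le> cmod z + cmod (x - z)" by (rule norm_triangle_sub)
      then show "m / 2 \<le> 1 - cmod x" using xz by (simp add: m_def dist_norm norm_minus_commute)
      then show "x \<in> ball 0 1" using m by simp
    qed
    have "cmod (deriv h \<zeta> - deriv h z) \<le> 2 * C * L / m * cmod (deriv h z) * cmod (\<zeta> - z)"
    proof (rule field_differentiable_bound[OF convex_cball, of z "\<epsilon> * m" _ "deriv (deriv h)"])
      fix x assume x: "x \<in> cball z (\<epsilon> * m)"
      show "(deriv h has_field_derivative deriv (deriv h) x) (at x within cball z (\<epsilon> * m))"
        by (rule deriv_h'[OF in_D(1)[OF x]])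
      have "m / 2 * cmod (deriv (deriv h) x) \<le> (1 - cmod x) * cmod (deriv (deriv h) x)"
        using in_D(2)[OF x] by (rule mult_right_mono) simp
      also have "\<dots> \<le> C * cmod (deriv h x)" by (rule C(2)[OF in_D(1)[OF x]])
      also have "\<dots> \<le> C * (L * cmod (deriv h z))"
        using L(2)[OF z] in_D(3)[OF x] C by (intro mult_left_mono) (auto simp: m_def)
      finally show "cmod (deriv (deriv h) x) \<le> 2 * C * L / m * cmod (deriv h z)"
        using m by (simp add: field_simps)
    qed (use \<zeta> m \<epsilon> in \<open>auto simp: m_def\<close>)
    also have "\<dots> \<le> 2 * C * L / m * cmod (deriv h z) * (\<epsilon> * m)"
      using \<zeta> C L m by (intro mult_left_mono) (auto simp: m_def dist_norm norm_minus_commute)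
    also have "\<dots> = 2 * C * L * \<epsilon> * cmod (deriv h z)" using m by simp
    also have "\<dots> \<le> \<eta> * cmod (deriv h z)" using \<epsilon>' by (rule mult_right_mono) simp
    finally show ?thesis .
  qed
  then show ?thesis using \<epsilon> by blast
qed

end

section \<open>Comparison with the distance to the boundary\<close>

lemma bdry_dist_ge:
  assumes "open \<Omega>" "frontier \<Omega> \<noteq> {}" "ball w m \<subseteq> \<Omega>"
  shows "m \<le> bdry_dist \<Omega> w"
proof -
  have "m \<le> dist w x" if "x \<in> frontier \<Omega>" for x
    using that assms by (force simp: frontier_def interior_open)
  then show ?thesis
    using assms(2) by (simp add: bdry_dist_def infdist_def cINF_greatest)
qed

text \<open>The disk is connected, meets \<open>\<Omega>\<close> and misses its frontier.\<close>

lemma ball_bdry_dist_subset: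
  assumes "w \<in> \<Omega>"
  shows "ball w (bdry_dist \<Omega> w) \<subseteq> \<Omega>"
proof (cases "bdry_dist \<Omega> w > 0")
  case True
  have "ball w (bdry_dist \<Omega> w) \<inter> frontier \<Omega> = {}"
    using infdist_le[of _ "frontier \<Omega>" w] by (fastforce simp: bdry_dist_def)
  then show ?thesis
    using connected_Int_frontier[of "ball w (bdry_dist \<Omega> w)" \<Omega>] assms True
    by (metis Diff_eq_empty_iff IntI centre_in_ball connected_ball empty_iff)
next
  case False
  then show ?thesis by (metis ball_eq_empty empty_subsetI not_less)
qed

context harmonic_qc_disk
begin

text \<open>On the disk of radius \<open>s = \<epsilon> (1 - \<bar>z\<bar>)\<close> the increment of \<open>h\<close> is \<open>h'(z) (\<zeta> - z)\<close> up to a small relative error,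
  and that of \<open>g\<close> is at most about \<open>k\<close> times as large. Hence \<open>\<bar>f \<zeta> - f z\<bar>\<close> stays above a fixed fraction of
  \<open>\<bar>h'(z)\<bar> s\<close> on the bounding circle, and the open image of the disk contains a disk of that radius.\<close>

lemma image_contains_ball:
  "\<exists>\<epsilon>>0. \<epsilon> \<le> 1/4 \<and> (\<forall>z\<in>ball 0 1.
     ball (f z) (\<epsilon> * (1 - k) / 2 * ((1 - cmod z) * cmod (deriv h z))) \<subseteq> f ` ball z (\<epsilon> * (1 - cmod z)))"
proof -
  define \<eta> where "\<eta> = (1 - k) / 4"
  have \<eta>: "\<eta> > 0" using k_less_1 by (simp add: \<eta>_def)
  obtain \<epsilon> where \<epsilon>: "\<epsilon> > 0" "\<epsilon> \<le> 1/4" and near: "\<And>z \<zeta>. z \<in> ball 0 1 \<Longrightarrow> \<zeta> \<in> cball z (\<epsilon> * (1 - cmod z)) \<Longrightarrow>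
           cmod (deriv h \<zeta> - deriv h z) \<le> \<eta> * cmod (deriv h z)"
    using deriv_h_near[OF \<eta>] by blast
  have "ball (f z) (\<epsilon> * (1 - k) / 2 * ((1 - cmod z) * cmod (deriv h z))) \<subseteq> f ` ball z (\<epsilon> * (1 - cmod z))"
    if z: "z \<in> ball 0 1" for z
  proof -
    define s where "s = \<epsilon> * (1 - cmod z)"
    have s: "s > 0" using z \<epsilon> by (simp add: s_def)
    have s1: "s < 1 - cmod z" using z \<epsilon> by (simp add: s_def)
    have sub: "cball z s \<subseteq> ball 0 1"
    proof
      fix x assume "x \<in> cball z s"
      moreover have "cmod x \<le> cmod z + cmod (x - z)" by (rule norm_triangle_sub)
      ultimately show "x \<in> ball 0 1" using s1 by (simp add: dist_norm norm_minus_commute)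
    qed
    define a where "a = cmod (deriv h z)"
    have h_lin: "cmod ((h \<zeta> - deriv h z * \<zeta>) - (h z - deriv h z * z)) \<le> \<eta> * a * cmod (\<zeta> - z)"
      if "\<zeta> \<in> cball z s" for \<zeta>
    proof (rule field_differentiable_bound[OF convex_cball, of z s _ "\<lambda>x. deriv h x - deriv h z"])
      fix x assume x: "x \<in> cball z s"
      show "((\<lambda>\<zeta>. h \<zeta> - deriv h z * \<zeta>) has_field_derivative deriv h x - deriv h z) (at x within cball z s)"
        using x sub by (auto intro!: derivative_eq_intros deriv_h)
      show "cmod (deriv h x - deriv h z) \<le> \<eta> * a"
        unfolding a_def using near[OF z] x by (simp add: s_def)
    qed (use that s in auto)
    have g_le: "cmod (g \<zeta> - g z) \<le> k * (1 + \<eta>) * a * cmod (\<zeta> - z)" if "\<zeta> \<in> cball z s" for \<zeta>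
    proof (rule field_differentiable_bound[OF convex_cball, of z s _ "deriv g"])
      fix x assume x: "x \<in> cball z s"
      show "(g has_field_derivative deriv g x) (at x within cball z s)"
        using x sub by (intro deriv_g) auto
      have "cmod (deriv h x) \<le> a + cmod (deriv h x - deriv h z)"
        unfolding a_def by (rule norm_triangle_sub)
      also have "\<dots> \<le> (1 + \<eta>) * a"
        using near[OF z, of x] x by (simp add: s_def a_def algebra_simps)
      finally have "k * cmod (deriv h x) \<le> k * ((1 + \<eta>) * a)" by (rule mult_left_mono[OF _ k_nonneg])
      moreover have "cmod (deriv g x) \<le> k * cmod (deriv h x)" using x sub by (intro dil) auto
      ultimately show "cmod (deriv g x) \<le> k * (1 + \<eta>) * a" by (simp add: mult.assoc)
    qed (use that s in auto)
    have lower: "(1 - k) / 2 * a * s \<le> cmod (f \<zeta> - f z)" if \<zeta>: "cmod (\<zeta> - z) = s" for \<zeta>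
    proof -
      have \<zeta>b: "\<zeta> \<in> cball z s" using \<zeta> by (simp add: dist_norm norm_minus_commute)
      define E where "E = ((h \<zeta> - deriv h z * \<zeta>) - (h z - deriv h z * z)) + cnj (g \<zeta> - g z)"
      have "f \<zeta> - f z = deriv h z * (\<zeta> - z) + E"
        using f_eq[of \<zeta>] f_eq[OF z] \<zeta>b sub by (simp add: E_def algebra_simps subset_iff)
      moreover have "cmod E \<le> \<eta> * a * s + k * (1 + \<eta>) * a * s"
        using h_lin[OF \<zeta>b] g_le[OF \<zeta>b] unfolding \<zeta> E_def
        by (intro norm_triangle_le add_mono) (simp_all only: complex_mod_cnj)
      moreover have "cmod (deriv h z * (\<zeta> - z)) = a * s" by (simp add: norm_mult a_def \<zeta>)
      ultimately have "a * s - (\<eta> * a * s + k * (1 + \<eta>) * a * s) \<le> cmod (f \<zeta> - f z)"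
        using norm_diff_ineq[of "deriv h z * (\<zeta> - z)" E] by simp
      moreover have "(1 - k) / 2 * (a * s) \<le> (1 - (\<eta> + k * (1 + \<eta>))) * (a * s)"
      proof (rule mult_right_mono)
        have "k * \<eta> \<le> 1 * \<eta>" using k_less_1 \<eta> by (intro mult_right_mono) auto
        moreover have "k * (1 + \<eta>) = k + k * \<eta>" "2 * \<eta> = (1 - k) / 2" by (simp_all add: \<eta>_def field_simps)
        ultimately show "(1 - k) / 2 \<le> 1 - (\<eta> + k * (1 + \<eta>))" by simp
      qed (use s in \<open>simp add: a_def\<close>)
      moreover have "(1 - (\<eta> + k * (1 + \<eta>))) * (a * s) = a * s - (\<eta> * a * s + k * (1 + \<eta>) * a * s)"
        by (simp add: algebra_simps)
      ultimately have "(1 - k) / 2 * (a * s) \<le> cmod (f \<zeta> - f z)" by linarith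
      then show ?thesis by (simp only: mult.assoc)
    qed
    have cover: "ball (f z) ((1 - k) / 2 * a * s) \<subseteq> f ` ball z s"
    proof (rule ball_subset_open_map_image)
      show "continuous_on (closure (ball z s)) f"
        using s sub continuous_on_subset[OF continuous_f] by simp
      show "open (f ` interior (ball z s))"
        using sub ball_subset_cball[of z s]
        by (intro invariance_of_domain continuous_on_subset[OF continuous_f] inj_on_subset[OF inj_f])
           (auto simp: interior_open)
      show "(1 - k) / 2 * a * s \<le> cmod (f \<zeta> - f z)" if "\<zeta> \<in> frontier (ball z s)" for \<zeta>
        using that s by (intro lower) (simp add: dist_norm norm_minus_commute)
      show "0 < (1 - k) / 2 * a * s" using s k_less_1 h'_nz[OF z] by (simp add: a_def)
    qed (use s in auto)
    have eq: "(1 - k) / 2 * a * s = \<epsilon> * (1 - k) / 2 * ((1 - cmod z) * cmod (deriv h z))"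
      by (simp add: a_def s_def)
    show ?thesis using cover unfolding eq unfolding s_def .
  qed
  then show ?thesis using \<epsilon> by blast
qed

lemma koebe_lower:
  assumes "frontier (f ` ball 0 1) \<noteq> {}"
  shows "\<exists>c>0. \<forall>z\<in>ball 0 1. (1 - cmod z) * cmod (deriv h z) \<le> c * bdry_dist (f ` ball 0 1) (f z)"
proof -
  obtain \<epsilon> where \<epsilon>: "\<epsilon> > 0" "\<epsilon> \<le> 1/4" "\<And>z. z \<in> ball 0 1 \<Longrightarrow>
     ball (f z) (\<epsilon> * (1 - k) / 2 * ((1 - cmod z) * cmod (deriv h z))) \<subseteq> f ` ball z (\<epsilon> * (1 - cmod z))"
    using image_contains_ball by blast
  define m where "m = \<epsilon> * (1 - k) / 2"
  have m: "m > 0" using \<epsilon> k_less_1 by (simp add: m_def)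
  have "(1 - cmod z) * cmod (deriv h z) \<le> 1 / m * bdry_dist (f ` ball 0 1) (f z)" if z: "z \<in> ball 0 1" for z
  proof -
    have "ball z (\<epsilon> * (1 - cmod z)) \<subseteq> ball 0 1"
    proof
      fix x assume "x \<in> ball z (\<epsilon> * (1 - cmod z))"
      moreover have "\<epsilon> * (1 - cmod z) \<le> 1 * (1 - cmod z)" using \<epsilon> z by (intro mult_right_mono) auto
      moreover have "cmod x \<le> cmod z + cmod (x - z)"
        by (rule norm_triangle_sub)
      ultimately show "x \<in> ball 0 1" by (simp add: dist_norm norm_minus_commute)
    qed
    then have "ball (f z) (m * ((1 - cmod z) * cmod (deriv h z))) \<subseteq> f ` ball 0 1"
      using \<epsilon>(3)[OF z] unfolding m_def by blast
    then have "m * ((1 - cmod z) * cmod (deriv h z)) \<le> bdry_dist (f ` ball 0 1) (f z)"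
      by (rule bdry_dist_ge[OF open_image_f assms])
    then show ?thesis using m by (simp add: field_simps)
  qed
  then show ?thesis using m by (intro exI[of _ "1/m"]) auto
qed

definition f_inv :: "complex \<Rightarrow> complex" where
  "f_inv = the_inv_into (ball 0 1) f"

lemma f_inv_f: "z \<in> ball 0 1 \<Longrightarrow> f_inv (f z) = z"
  unfolding f_inv_def by (rule the_inv_into_f_f[OF inj_f])

lemma f_inv_in_disk: "u \<in> f ` ball 0 1 \<Longrightarrow> f_inv u \<in> ball 0 1"
  and f_f_inv: "u \<in> f ` ball 0 1 \<Longrightarrow> f (f_inv u) = u"
  using f_inv_f by auto

lemma continuous_f_inv: "continuous_on (f ` ball 0 1) f_inv"
  by (rule continuous_on_inverse_open) (use continuous_f f_inv_f in auto)

text \<open>The given linear map is the inverse of \<open>v \<mapsto> a v + cnj (b v)\<close>.\<close>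

lemma has_derivative_f_inv:
  assumes u: "u \<in> f ` ball 0 1"
  defines "a \<equiv> deriv h (f_inv u)" and "b \<equiv> deriv g (f_inv u)"
  shows "(f_inv has_derivative (\<lambda>y. (cnj a * y - cnj b * cnj y) / of_real ((cmod a)\<^sup>2 - (cmod b)\<^sup>2))) (at u)"
proof (rule has_derivative_inverse_basic[OF _ _ _ _ open_image_f u])
  show "(f has_derivative (\<lambda>v. a * v + cnj (b * v))) (at (f_inv u))"
    unfolding a_def b_def by (rule has_derivative_f[OF f_inv_in_disk[OF u]])
  show "continuous (at u) f_inv"
    using continuous_f_inv u continuous_on_eq_continuous_at[OF open_image_f] by blast
  have a0: "a \<noteq> 0" unfolding a_def by (rule h'_nz[OF f_inv_in_disk[OF u]])
  have "cmod b \<le> k * cmod a" unfolding a_def b_def by (rule dil[OF f_inv_in_disk[OF u]])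
  also have "\<dots> < cmod a" using a0 k_less_1 by simp
  finally have J: "(cmod a)\<^sup>2 - (cmod b)\<^sup>2 \<noteq> 0"
    by (smt (verit) norm_ge_zero power2_eq_iff_nonneg)
  have "(cnj a * (a * v + cnj (b * v)) - cnj b * cnj (a * v + cnj (b * v)))
      = of_real ((cmod a)\<^sup>2 - (cmod b)\<^sup>2) * v" for v
    unfolding of_real_diff complex_norm_square by (simp add: algebra_simps)
  then show "(\<lambda>y. (cnj a * y - cnj b * cnj y) / of_real ((cmod a)\<^sup>2 - (cmod b)\<^sup>2)) \<circ> (\<lambda>v. a * v + cnj (b * v)) = id"
    using J by (auto simp: fun_eq_iff simp del: of_real_diff)
  show "bounded_linear (\<lambda>y. (cnj a * y - cnj b * cnj y) / of_real ((cmod a)\<^sup>2 - (cmod b)\<^sup>2))"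
    by (intro bounded_linear_intros bounded_linear_divide[THEN bounded_linear_compose]
          bounded_linear_cnj[THEN bounded_linear_compose] bounded_linear_sub bounded_linear_const_mult)
qed (use f_f_inv in auto)

text \<open>Along a segment in direction \<open>v\<close> the derivative of \<open>h \<circ> f\<^sup>-\<^sup>1\<close> is a vector \<open>w = a T\<close> with \<open>v = w + cnj (b T)\<close>, and
  \<open>\<bar>b T\<bar> \<le> \<bar>w\<bar>\<close>. So \<open>\<bar>v - w\<bar> \<le> \<bar>w\<bar>\<close>, which is the same as \<open>Re (cnj v w) \<ge> \<bar>v\<bar>\<^sup>2 / 2\<close>. Convexity of \<open>B\<close> allows this to be
  integrated from \<open>u2\<close> to \<open>u1\<close>.\<close>

lemma h_f_inv_strongly_monotone:
  assumes B: "convex B" "B \<subseteq> f ` ball 0 1" and u: "u1 \<in> B" "u2 \<in> B"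
  shows "(cmod (u1 - u2))\<^sup>2 / 2 \<le> Re (cnj (u1 - u2) * (h (f_inv u1) - h (f_inv u2)))"
proof -
  define v where "v = u1 - u2"
  define \<psi> where "\<psi> = (\<lambda>t::real. Re (cnj v * h (f_inv (u2 + of_real t * v))) - t * ((cmod v)\<^sup>2 / 2))"
  have "\<psi> 0 \<le> \<psi> 1"
  proof (rule DERIV_nonneg_imp_nondecreasing[of 0 1 \<psi>])
    fix t :: real assume t: "0 \<le> t" "t \<le> 1"
    have "u2 + of_real t * v = (1 - t) *\<^sub>R u2 + t *\<^sub>R u1"
      by (simp add: v_def scaleR_conv_of_real algebra_simps)
    then have "u2 + of_real t * v \<in> B"
      using B(1) u t by (simp add: convex_alt)
    then have pt: "u2 + of_real t * v \<in> f ` ball 0 1" using B by blast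
    define z where "z = f_inv (u2 + of_real t * v)"
    have z: "z \<in> ball 0 1" unfolding z_def by (rule f_inv_in_disk[OF pt])
    define a where "a = deriv h z"
    define b where "b = deriv g z"
    define T where "T = (cnj a * v - cnj b * cnj v) / of_real ((cmod a)\<^sup>2 - (cmod b)\<^sup>2)"
    have a0: "a \<noteq> 0" unfolding a_def by (rule h'_nz[OF z])
    have b_le: "cmod b \<le> k * cmod a" unfolding a_def b_def by (rule dil[OF z])
    also have "\<dots> < cmod a" using a0 k_less_1 by simp
    finally have ba: "cmod b < cmod a" .
    then have J: "(cmod a)\<^sup>2 - (cmod b)\<^sup>2 \<noteq> 0"
      by (smt (verit) norm_ge_zero power2_eq_iff_nonneg)
    have "(cnj a * v - cnj b * cnj v) * a + cnj ((cnj a * v - cnj b * cnj v) * b) = of_real ((cmod a)\<^sup>2 - (cmod b)\<^sup>2) * v"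
      unfolding of_real_diff complex_norm_square by (simp add: algebra_simps)
    then have "a * T + cnj (b * T) = v"
      unfolding T_def using J by (simp add: field_simps del: of_real_diff)
    then have vT: "v - a * T = cnj (b * T)" by (simp add: algebra_simps)
    have "cmod (v - a * T) \<le> cmod (a * T)"
      unfolding vT using ba by (simp add: norm_mult mult_right_mono)
    then have "(cmod (v - a * T))\<^sup>2 \<le> (cmod (a * T))\<^sup>2" by (intro power_mono) auto
    moreover have "(cmod (v - w))\<^sup>2 = (cmod v)\<^sup>2 + (cmod w)\<^sup>2 - 2 * Re (cnj v * w)" for w
      unfolding cmod_power2 by (simp add: power2_eq_square algebra_simps)
    ultimately have pos: "(cmod v)\<^sup>2 / 2 \<le> Re (cnj v * (a * T))" by simp
    have line: "((\<lambda>t. u2 + of_real t * v) has_vector_derivative v) (at t)"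
      by (auto simp: has_vector_derivative_def scaleR_conv_of_real intro!: derivative_eq_intros)
    have "(f_inv has_derivative (\<lambda>y. (cnj a * y - cnj b * cnj y) / of_real ((cmod a)\<^sup>2 - (cmod b)\<^sup>2))) (at (u2 + of_real t * v))"
      using has_derivative_f_inv[OF pt] unfolding a_def b_def z_def .
    from vector_derivative_diff_chain_within[of "\<lambda>t. u2 + of_real t * v" v t UNIV, OF line has_derivative_at_withinI[OF this]]
    have "((f_inv \<circ> (\<lambda>t. u2 + of_real t * v)) has_vector_derivative T) (at t)"
      by (simp add: T_def)
    from field_vector_diff_chain_at[OF this, of h a]
    have "((h \<circ> (f_inv \<circ> (\<lambda>t. u2 + of_real t * v))) has_vector_derivative T * a) (at t)"
      using deriv_h[OF z] unfolding a_def z_def by simp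
    then have "((\<lambda>t. cnj v * h (f_inv (u2 + of_real t * v))) has_vector_derivative cnj v * (T * a)) (at t)"
      by (intro has_vector_derivative_mult_right) (simp add: o_def)
    then have "((\<lambda>t. Re (cnj v * h (f_inv (u2 + of_real t * v)))) has_vector_derivative Re (cnj v * (T * a))) (at t)"
      by (rule bounded_linear.has_vector_derivative[OF bounded_linear_Re])
    then have "((\<lambda>t. Re (cnj v * h (f_inv (u2 + of_real t * v)))) has_real_derivative Re (cnj v * (T * a))) (at t)"
      by (simp add: has_real_derivative_iff_has_vector_derivative)
    from DERIV_diff[OF this DERIV_cmult_right[OF DERIV_ident, of "(cmod v)\<^sup>2 / 2"]]
    have "(\<psi> has_real_derivative Re (cnj v * (T * a)) - (cmod v)\<^sup>2 / 2) (at t)"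
      unfolding \<psi>_def by simp
    moreover have "Re (cnj v * (T * a)) - (cmod v)\<^sup>2 / 2 \<ge> 0" using pos by (simp add: mult.commute[of T a])
    ultimately show "\<exists>y. (\<psi> has_real_derivative y) (at t) \<and> 0 \<le> y" by blast
  qed auto
  then show ?thesis by (simp add: \<psi>_def v_def algebra_simps)
qed

text \<open>Strong monotonicity makes \<open>q = h \<circ> f\<^sup>-\<^sup>1\<close> expand distances by at least \<open>1/2\<close> on the disk of radius \<open>s = d / 2\<close> about
  \<open>f z\<close>. Hence \<open>h\<close> is injective on the preimage \<open>U\<close> of that disk, and \<open>h(U)\<close> contains the disk of radius \<open>s / 2\<close>
  about \<open>h z\<close>. The inverse \<open>p\<close> of \<open>h\<close> maps this disk into the unit disk and \<open>h z\<close> to \<open>z\<close>, so by Schwarz and Pick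
  \<open>\<bar>p'(h z)\<bar> s / 2 \<le> 1 - \<bar>z\<bar>\<^sup>2\<close>, where \<open>p'(h z) = 1 / h'(z)\<close>.\<close>

lemma koebe_upper:
  assumes z: "z \<in> ball 0 1"
  shows "bdry_dist (f ` ball 0 1) (f z) \<le> 8 * ((1 - cmod z) * cmod (deriv h z))"
proof (cases "bdry_dist (f ` ball 0 1) (f z) > 0")
  case False
  moreover have "0 \<le> (1 - cmod z) * cmod (deriv h z)" using z by simp
  ultimately show ?thesis by linarith
next
  case True
  define d where "d = bdry_dist (f ` ball 0 1) (f z)"
  have ballD: "ball (f z) d \<subseteq> f ` ball 0 1"
    unfolding d_def by (rule ball_bdry_dist_subset) (use z in auto)
  define s where "s = d / 2"
  have s: "s > 0" "s < d" using True by (auto simp: s_def d_def)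
  define q where "q = (\<lambda>u. h (f_inv u))"
  have sub: "cball (f z) s \<subseteq> f ` ball 0 1" using ballD s by force
  have q_expand: "cmod (u1 - u2) / 2 \<le> cmod (q u1 - q u2)" if "u1 \<in> cball (f z) s" "u2 \<in> cball (f z) s" for u1 u2
  proof (cases "u1 = u2")
    case False
    have "(cmod (u1 - u2))\<^sup>2 / 2 \<le> Re (cnj (u1 - u2) * (q u1 - q u2))"
      unfolding q_def by (rule h_f_inv_strongly_monotone[OF convex_cball sub that])
    also have "\<dots> \<le> cmod (cnj (u1 - u2) * (q u1 - q u2))" by (rule complex_Re_le_cmod)
    also have "\<dots> = cmod (u1 - u2) * cmod (q u1 - q u2)" by (simp only: norm_mult complex_mod_cnj)
    finally have "cmod (u1 - u2) * (cmod (u1 - u2) / 2) \<le> cmod (u1 - u2) * cmod (q u1 - q u2)"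
      by (simp add: power2_eq_square)
    then show ?thesis using False by (simp only: mult_le_cancel_left_pos zero_less_norm_iff right_minus_eq not_False_eq_True)
  qed simp
  have cont_q: "continuous_on (cball (f z) s) q"
    unfolding q_def using sub f_inv_in_disk
    by (intro continuous_on_compose2[OF holomorphic_on_imp_continuous_on[OF hol_h] continuous_on_subset[OF continuous_f_inv]]) auto
  have inj_q: "inj_on q (ball (f z) s)"
  proof (rule inj_onI)
    fix x y assume "x \<in> ball (f z) s" "y \<in> ball (f z) s" "q x = q y"
    then show "x = y" using q_expand[of x y] by auto
  qed
  have z_eq: "q (f z) = h z" by (simp add: q_def f_inv_f[OF z])
  have "ball (q (f z)) (s / 2) \<subseteq> q ` ball (f z) s"
  proof (rule ball_subset_open_map_image)
    show "continuous_on (closure (ball (f z) s)) q" using cont_q s by simp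
    show "open (q ` interior (ball (f z) s))"
      using inj_q by (simp add: interior_open)
        (intro invariance_of_domain continuous_on_subset[OF cont_q], auto)
    show "s / 2 \<le> cmod (q u - q (f z))" if "u \<in> frontier (ball (f z) s)" for u
      using that s q_expand[of u "f z"] by (simp add: dist_norm norm_minus_commute)
  qed (use s in auto)
  then have cover: "ball (h z) (s / 2) \<subseteq> h ` (f_inv ` ball (f z) s)"
    unfolding z_eq by (simp add: q_def image_image)
  define U where "U = f_inv ` ball (f z) s"
  have bsub: "ball (f z) s \<subseteq> f ` ball 0 1" using sub ball_subset_cball by blast
  have U_D: "U \<subseteq> ball 0 1" using bsub f_inv_in_disk unfolding U_def by blast
  have "inj_on f_inv (ball (f z) s)"
    using bsub f_f_inv by (metis inj_onI subsetD)
  then have openU: "open U"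
    unfolding U_def using bsub by (intro invariance_of_domain continuous_on_subset[OF continuous_f_inv]) auto
  have "inj_on h U"
    using inj_q unfolding U_def q_def inj_on_def by auto
  then obtain p where p: "p holomorphic_on (h ` U)" "\<And>x. x \<in> U \<Longrightarrow> deriv h x * deriv p (h x) = 1"
    "\<And>x. x \<in> U \<Longrightarrow> p (h x) = x"
    using holomorphic_has_inverse[OF holomorphic_on_subset[OF hol_h U_D] openU] by metis
  have zU: "z \<in> U" unfolding U_def using s f_inv_f[OF z] by (metis centre_in_ball imageI)
  (* normalised so that the Schwarz lemma on the unit disk applies *)
  define \<Phi> where "\<Phi> = (\<lambda>x. Moebius_function 0 z (p (h z + of_real (s / 2) * x)))"
  have inner: "h z + of_real (s / 2) * x \<in> h ` U" if "x \<in> ball 0 1" for x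
  proof -
    have "h z + of_real (s / 2) * x \<in> ball (h z) (s / 2)"
      using that s by (simp add: dist_norm norm_mult)
    then show ?thesis using cover unfolding U_def by blast
  qed
  have p_D: "p y \<in> ball 0 1" if "y \<in> h ` U" for y using that p(3) U_D by auto
  have z1: "cmod z < 1" using z by simp
  have "cmod (deriv \<Phi> 0) \<le> 1"
  proof (rule Schwarz_Lemma(2))
    have "(p \<circ> (\<lambda>x. h z + of_real (s / 2) * x)) holomorphic_on ball 0 1"
      using inner by (intro holomorphic_on_compose_gen[OF _ p(1)] holomorphic_intros) auto
    then have "(Moebius_function 0 z \<circ> (p \<circ> (\<lambda>x. h z + of_real (s / 2) * x))) holomorphic_on ball 0 1"
      using inner p_D by (intro holomorphic_on_compose_gen[OF _ Moebius_function_holomorphic[OF z1]]) auto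
    then show "\<Phi> holomorphic_on ball 0 1" by (simp add: \<Phi>_def o_def)
    show "\<Phi> 0 = 0" using p(3)[OF zU] by (simp add: \<Phi>_def Moebius_function_eq_zero)
    show "cmod (\<Phi> x) < 1" if "cmod x < 1" for x
      unfolding \<Phi>_def using p_D[OF inner[of x]] that by (intro Moebius_function_norm_lt_1[OF z1]) auto
    show "cmod (0::complex) < 1" by simp
  qed
  moreover have "deriv \<Phi> 0 = 1 / of_real (1 - (cmod z)\<^sup>2) * (deriv p (h z) * of_real (s / 2))"
  proof (rule DERIV_imp_deriv)
    have "open (h ` U)" by (rule open_mapping_thm3[OF holomorphic_on_subset[OF hol_h U_D] openU \<open>inj_on h U\<close>])
    then have dp: "(p has_field_derivative deriv p (h z)) (at (h z + of_real (s / 2) * 0))"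
      using p(1) zU by (simp add: holomorphic_derivI)
    have nz: "1 - cnj z * z \<noteq> 0"
    proof -
      have "(cmod z)\<^sup>2 < 1" using z1 by (simp add: abs_square_less_1)
      then have "1 - complex_of_real ((cmod z)\<^sup>2) \<noteq> 0"
        by (metis eq_iff_diff_eq_0 less_irrefl of_real_1 of_real_eq_iff)
      then show ?thesis unfolding complex_norm_square by (simp add: mult.commute)
    qed
    have "((\<lambda>w. (w - z) / (1 - cnj z * w)) has_field_derivative (1 - cnj z * z) / ((1 - cnj z * z) * (1 - cnj z * z))) (at z)"
      using nz by (auto intro!: derivative_eq_intros)
    then have "(Moebius_function 0 z has_field_derivative (1 - cnj z * z) / ((1 - cnj z * z) * (1 - cnj z * z))) (at z)"
      by (simp add: Moebius_function_simple[abs_def])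
    then have dM: "(Moebius_function 0 z has_field_derivative 1 / of_real (1 - (cmod z)\<^sup>2)) (at (p (h z + of_real (s / 2) * 0)))"
      using nz p(3)[OF zU] unfolding of_real_diff complex_norm_square by (simp add: mult.commute)
    have "((\<lambda>x. h z + of_real (s / 2) * x) has_field_derivative of_real (s / 2)) (at 0)"
      by (auto intro!: derivative_eq_intros)
    from DERIV_chain2[OF dM DERIV_chain2[OF dp this]]
    show "(\<Phi> has_field_derivative 1 / of_real (1 - (cmod z)\<^sup>2) * (deriv p (h z) * of_real (s / 2))) (at 0)"
      unfolding \<Phi>_def .
  qed
  moreover have "deriv p (h z) = 1 / deriv h z"
    using p(2)[OF zU] h'_nz[OF z] by (simp add: field_simps)
  ultimately have "cmod (1 / of_real (1 - (cmod z)\<^sup>2) * (1 / deriv h z * of_real (s / 2))) \<le> 1"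
    by simp
  moreover have pos: "1 - (cmod z)\<^sup>2 > 0" using z1 by (simp add: abs_square_less_1)
  ultimately have "(s / 2) / ((1 - (cmod z)\<^sup>2) * cmod (deriv h z)) \<le> 1"
    using s by (simp only: norm_mult norm_divide norm_of_real norm_one) (simp add: mult_ac)
  then have "s / 2 \<le> (1 - (cmod z)\<^sup>2) * cmod (deriv h z)"
    using pos h'_nz[OF z] by (simp add: divide_le_eq)
  also have "1 - (cmod z)\<^sup>2 = (1 + cmod z) * (1 - cmod z)" by (simp add: power2_eq_square algebra_simps)
  also have "(1 + cmod z) * (1 - cmod z) * cmod (deriv h z) \<le> 2 * (1 - cmod z) * cmod (deriv h z)"
    using z1 by (intro mult_right_mono) auto
  finally show ?thesis by (simp add: s_def d_def algebra_simps)
qed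

end

section \<open>Curve length, boxes in polar coordinates, and packing of disks\<close>

lemma dist_le_curve_length:
  assumes "a \<le> b"
  shows "ennreal (dist (\<gamma> a) (\<gamma> b)) \<le> curve_length \<gamma> a b"
  unfolding curve_length_def using assms by (intro SUP_upper2[of "[a, b]"]) auto

text \<open>If \<open>\<Phi>\<close> dominates the increments of \<open>\<gamma>\<close>, the sum over a partition telescopes.\<close>

lemma curve_length_le:
  assumes "a \<le> b"
    and step: "\<And>s t. a \<le> s \<Longrightarrow> s \<le> t \<Longrightarrow> t \<le> b \<Longrightarrow> dist (\<gamma> s) (\<gamma> t) \<le> \<Phi> s - \<Phi> t"
  shows "curve_length \<gamma> a b \<le> ennreal (\<Phi> a - \<Phi> b)"
  unfolding curve_length_def
proof (rule SUP_least)
  fix ts assume "ts \<in> {ts. sorted ts \<and> set ts \<subseteq> {a..b}}"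
  then have ts: "sorted ts" "\<And>i. i < length ts \<Longrightarrow> ts ! i \<in> {a..b}"
    using nth_mem by blast+
  have mono: "\<Phi> t \<le> \<Phi> s" if "a \<le> s" "s \<le> t" "t \<le> b" for s t
    using step[OF that] zero_le_dist[of "\<gamma> s" "\<gamma> t"] by linarith
  have "(\<Sum>i<length ts - 1. dist (\<gamma> (ts ! i)) (\<gamma> (ts ! Suc i))) \<le> \<Phi> a - \<Phi> b"
  proof (cases "ts = []")
    case True
    then show ?thesis using mono[of a b] assms(1) by simp
  next
    case False
    have "(\<Sum>i<length ts - 1. dist (\<gamma> (ts ! i)) (\<gamma> (ts ! Suc i)))
        \<le> (\<Sum>i<length ts - 1. \<Phi> (ts ! i) - \<Phi> (ts ! Suc i))"
    proof (rule sum_mono)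
      fix i assume "i \<in> {..<length ts - 1}"
      then have i: "i < length ts" "Suc i < length ts" by auto
      show "dist (\<gamma> (ts ! i)) (\<gamma> (ts ! Suc i)) \<le> \<Phi> (ts ! i) - \<Phi> (ts ! Suc i)"
        using ts(2)[OF i(1)] ts(2)[OF i(2)] sorted_nth_mono[OF ts(1), of i "Suc i"] i by (intro step) auto
    qed
    also have "\<dots> = \<Phi> (ts ! 0) - \<Phi> (ts ! (length ts - 1))"
      by (rule sum_lessThan_telescope')
    also have "\<dots> \<le> \<Phi> a - \<Phi> b"
      using ts(2)[of 0] ts(2)[of "length ts - 1"] False mono[of a "ts ! 0"] mono[of "ts ! (length ts - 1)" b] by force
    finally show ?thesis .
  qed
  then show "ennreal (\<Sum>i<length ts - 1. dist (\<gamma> (ts ! i)) (\<gamma> (ts ! Suc i))) \<le> ennreal (\<Phi> a - \<Phi> b)"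
    by (rule ennreal_leI)
qed

text \<open>Boxes are defined with the principal argument; the following lemmas allow arbitrary real
  angles instead.\<close>

lemma Arg_rcis_cong:
  assumes "r > 0"
  shows "\<exists>n::int. \<theta> = Arg (rcis r \<theta>) + 2 * pi * of_int n"
proof -
  have "cis (Arg (rcis r \<theta>)) = cis \<theta>"
    using assms by (simp add: cis_Arg sgn_div_norm rcis_def scaleR_conv_of_real norm_mult)
  then have "exp (\<i> * of_real \<theta>) = exp (\<i> * of_real (Arg (rcis r \<theta>)))"
    by (simp add: cis_conv_exp)
  then obtain n :: int where "\<i> * of_real \<theta> = \<i> * of_real (Arg (rcis r \<theta>)) + (of_int (2 * n) * pi) * \<i>"
    unfolding exp_eq by blast
  then have "\<theta> = Arg (rcis r \<theta>) + 2 * pi * of_int n"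
    by (simp add: complex_eq_iff mult_ac)
  then show ?thesis by blast
qed

lemma rcis_in_Bbox:
  assumes "0 \<le> r" "r \<le> \<rho>" "\<rho> < 1" "\<bar>\<phi> - \<theta>\<bar> \<le> pi * (1 - r)"
  shows "rcis \<rho> \<phi> \<in> Bbox (rcis r \<theta>)"
proof (cases "r = 0")
  case True
  then show ?thesis using assms by (simp add: Bbox_0)
next
  case False
  obtain n1 :: int where n1: "\<theta> = Arg (rcis r \<theta>) + 2 * pi * of_int n1"
    using Arg_rcis_cong[of r \<theta>] False assms by auto
  obtain n2 :: int where n2: "\<phi> = Arg (rcis \<rho> \<phi>) + 2 * pi * of_int n2"
    using Arg_rcis_cong[of \<rho> \<phi>] False assms by auto
  have "Arg (rcis r \<theta>) - Arg (rcis \<rho> \<phi>) + 2 * pi * of_int (n1 - n2) = \<theta> - \<phi>"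
    using n1 n2 by (simp add: algebra_simps)
  then have "\<bar>Arg (rcis r \<theta>) - Arg (rcis \<rho> \<phi>) + 2 * pi * of_int (n1 - n2)\<bar> \<le> pi * (1 - r)"
    using assms(4) by (simp add: abs_minus_commute)
  then show ?thesis unfolding Bbox_def using assms by (auto intro!: exI[of _ "n1 - n2"])
qed

lemma Bbox_polar:
  assumes "\<zeta> \<in> Bbox z"
  obtains \<phi> where "\<zeta> = rcis (cmod \<zeta>) \<phi>" "\<bar>\<phi> - Arg z\<bar> \<le> pi * (1 - cmod z)"
    "cmod z \<le> cmod \<zeta>" "cmod \<zeta> < 1"
proof -
  obtain n :: int where n: "\<bar>Arg z - Arg \<zeta> + 2 * pi * of_int n\<bar> \<le> pi * (1 - cmod z)"
    and \<zeta>: "cmod z \<le> cmod \<zeta>" "cmod \<zeta> < 1"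
    using assms by (auto simp: Bbox_def)
  have "cis (2 * pi * of_int n) = 1" by (rule cis_multiple_2pi) simp
  then have "rcis (cmod \<zeta>) (Arg \<zeta> - 2 * pi * of_int n) = rcis (cmod \<zeta>) (Arg \<zeta>)"
    unfolding rcis_def cis_divide[symmetric] by simp
  then have "\<zeta> = rcis (cmod \<zeta>) (Arg \<zeta> - 2 * pi * of_int n)"
    by (simp add: rcis_cmod_Arg)
  then show thesis using n \<zeta> by (intro that[of "Arg \<zeta> - 2 * pi * of_int n"]) auto
qed

text \<open>Comparison of areas.\<close>

lemma sum_squares_disjoint_balls_le:
  fixes c :: "nat \<Rightarrow> complex"
  assumes "finite I" and disj: "disjoint_family_on (\<lambda>i. ball (c i) (\<rho> i)) I"
    and \<rho>: "\<And>i. i \<in> I \<Longrightarrow> \<rho> i \<ge> 0" and sub: "\<And>i. i \<in> I \<Longrightarrow> ball (c i) (\<rho> i) \<subseteq> cball x D" and D: "D \<ge> 0"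
  shows "(\<Sum>i\<in>I. (\<rho> i)\<^sup>2) \<le> D\<^sup>2"
proof -
  define v where "v = measure lborel (ball (0::complex) 1)"
  have v: "v > 0" unfolding v_def by (rule content_ball_pos) simp
  have ball_area: "measure lborel (ball (y::complex) r) = r\<^sup>2 * v" if "r \<ge> 0" for y r
    using content_ball_conv_unit_ball[OF that, of y] by (simp add: v_def)
  have "(\<Sum>i\<in>I. (\<rho> i)\<^sup>2 * v) = (\<Sum>i\<in>I. measure lborel (ball (c i) (\<rho> i)))"
    using \<rho> by (intro sum.cong) (simp_all add: ball_area)
  also have "\<dots> = measure lborel (\<Union>i\<in>I. ball (c i) (\<rho> i))"
    using assms(1) disj emeasure_lborel_ball_finite
    by (intro measure_finite_Union[symmetric]) (auto simp: less_top[symmetric])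
  also have "\<dots> \<le> measure lborel (cball x D)"
  proof (rule measure_mono_fmeasurable)
    show "cball x D \<in> fmeasurable lborel"
      using emeasure_lborel_cball_finite[of x D] by (simp add: fmeasurable_def)
    show "(\<Union>i\<in>I. ball (c i) (\<rho> i)) \<in> sets lborel" by (simp add: borel_open open_UN)
  qed (use sub in auto)
  also have "\<dots> = D\<^sup>2 * v" using D by (simp add: content_cball_conv_ball ball_area)
  finally show ?thesis using v by (simp flip: sum_distrib_right)
qed

text \<open>With \<open>S\<^sub>n\<close> the sum from \<open>n\<close> to \<open>N\<close>, the hypothesis reads \<open>S\<^sub>n\<^sub>+\<^sub>1 \<le> A (S\<^sub>n - S\<^sub>n\<^sub>+\<^sub>1)\<close>, that is
  \<open>S\<^sub>n\<^sub>+\<^sub>1 \<le> A / (1 + A) S\<^sub>n\<close>.\<close>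

lemma geometric_decay_of_tail_sums:
  fixes a :: "nat \<Rightarrow> real"
  assumes A: "A > 0" and nonneg: "\<And>n. a n \<ge> 0"
    and tail: "\<And>n N. n < N \<Longrightarrow> (\<Sum>m=Suc n..N. a m) \<le> A * a n"
  shows "a N \<le> (1 + A) * (A / (1 + A)) ^ N * a 0"
proof -
  define \<kappa> where "\<kappa> = A / (1 + A)"
  have \<kappa>: "\<kappa> \<ge> 0" using A by (simp add: \<kappa>_def)
  have "(\<Sum>m=n..N. a m) \<le> \<kappa> ^ n * ((1 + A) * a 0)" if "n \<le> N" for n
    using that
  proof (induction n)
    case 0
    have "(\<Sum>m=0..N. a m) = a 0 + (\<Sum>m=Suc 0..N. a m)" by (simp add: sum.atLeast_Suc_atMost)
    also have "(\<Sum>m=Suc 0..N. a m) \<le> A * a 0"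
      using tail[of 0 N] A nonneg[of 0] by (cases N) auto
    finally show ?case by (simp add: algebra_simps)
  next
    case (Suc n)
    define T where "T = (\<Sum>m=Suc n..N. a m)"
    have "(\<Sum>m=n..N. a m) = a n + T" using Suc.prems by (simp add: sum.atLeast_Suc_atMost T_def)
    moreover have "T \<le> A * a n" using tail[of n N] Suc.prems by (simp add: T_def)
    ultimately have "(1 + A) * T \<le> A * (\<Sum>m=n..N. a m)" by (simp add: algebra_simps)
    then have "T \<le> \<kappa> * (\<Sum>m=n..N. a m)" using A by (simp add: \<kappa>_def field_simps)
    also have "\<dots> \<le> \<kappa> * (\<kappa> ^ n * ((1 + A) * a 0))" using Suc \<kappa> by (intro mult_left_mono) auto
    finally show ?case by (simp add: T_def)
  qed
  from this[of N] show ?thesis by (simp add: \<kappa>_def mult_ac)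
qed

section \<open>The three implications\<close>

context harmonic_qc_disk
begin

text \<open>From \<open>z\<close> go along the arc to the point \<open>w\<close> of modulus \<open>\<bar>z\<bar>\<close> on the radius of \<open>\<zeta>\<close>, then along this radius. The
  first step moves the image, and with it the distance to the boundary, by a bounded multiple of the distance at \<open>f z\<close>; for
  the second the John condition applies, with \<open>w\<close> as the point on the curve.\<close>

lemma radial_John_imp_diameter_bound:
  assumes fr: "frontier (f ` ball 0 1) \<noteq> {}" and John: "radial_c_John_disk c f"
  shows "\<exists>M>0. \<forall>z\<in>ball 0 1. diameter (f ` Bbox z) \<le> M * bdry_dist (f ` ball 0 1) (f z)"
proof -
  define d where "d = (\<lambda>z. bdry_dist (f ` ball 0 1) (f z))"
  have d0: "d z \<ge> 0" for z by (simp add: d_def bdry_dist_def infdist_nonneg)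
  have c: "c \<ge> 1" using John by (simp add: radial_c_John_disk_def)
  obtain c1 where c1: "c1 > 0" "\<And>r \<alpha> \<beta>. 0 \<le> r \<Longrightarrow> r < 1 \<Longrightarrow> \<bar>\<alpha> - \<beta>\<bar> \<le> pi * (1 - r) \<Longrightarrow>
     cmod (f (rcis r \<alpha>) - f (rcis r \<beta>)) \<le> c1 * ((1 - r) * cmod (deriv h (rcis r \<beta>)))"
    using arc_image_bound by blast
  obtain c2 where c2: "c2 > 0" "\<And>z. z \<in> ball 0 1 \<Longrightarrow> (1 - cmod z) * cmod (deriv h z) \<le> c2 * d z"
    unfolding d_def using koebe_lower[OF fr] by blast
  have radial: "dist (f (of_real t * \<zeta>)) (f \<zeta>) \<le> c * d (of_real t * \<zeta>)" if \<zeta>: "\<zeta> \<in> ball 0 1" and t: "0 \<le> t" "t \<le> 1" for \<zeta> t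
  proof -
    have eq: "(f \<circ> linepath 0 \<zeta>) t = f (of_real t * \<zeta>)" "(f \<circ> linepath 0 \<zeta>) 1 = f \<zeta>"
      by (simp_all add: linepath_def scaleR_conv_of_real)
    have "ennreal (dist ((f \<circ> linepath 0 \<zeta>) t) ((f \<circ> linepath 0 \<zeta>) 1)) \<le> curve_length (f \<circ> linepath 0 \<zeta>) t 1"
      by (rule dist_le_curve_length[OF t(2)])
    also have "\<dots> \<le> ennreal (c * bdry_dist (f ` ball 0 1) ((f \<circ> linepath 0 \<zeta>) t))"
      using John \<zeta> t by (auto simp: radial_c_John_disk_def)
    finally have "ennreal (dist (f (of_real t * \<zeta>)) (f \<zeta>)) \<le> ennreal (c * d (of_real t * \<zeta>))"
      unfolding eq d_def .
    moreover have "0 \<le> c * d (of_real t * \<zeta>)" using c d0[of "of_real t * \<zeta>"] by simp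
    ultimately show ?thesis using ennreal_le_iff by blast
  qed
  define M where "M = c1 * c2 + c * (1 + c1 * c2)"
  have M: "M > 0" using c c1 c2 by (simp add: M_def add_pos_pos)
  have near: "cmod (f \<zeta> - f z) \<le> M * d z" if z: "z \<in> ball 0 1" and \<zeta>: "\<zeta> \<in> Bbox z" for z \<zeta>
  proof -
    obtain \<phi> where \<phi>: "\<zeta> = rcis (cmod \<zeta>) \<phi>" "\<bar>\<phi> - Arg z\<bar> \<le> pi * (1 - cmod z)"
      "cmod z \<le> cmod \<zeta>" "cmod \<zeta> < 1"
      using Bbox_polar[OF \<zeta>] .
    define w where "w = rcis (cmod z) \<phi>"
    have "cmod (f w - f (rcis (cmod z) (Arg z))) \<le> c1 * ((1 - cmod z) * cmod (deriv h (rcis (cmod z) (Arg z))))"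
      unfolding w_def using \<phi> z by (intro c1(2)) auto
    then have "cmod (f w - f z) \<le> c1 * ((1 - cmod z) * cmod (deriv h z))" by (simp add: rcis_cmod_Arg)
    also have "\<dots> \<le> c1 * (c2 * d z)" using c2(2)[OF z] c1 by (intro mult_left_mono) auto
    finally have fw: "cmod (f w - f z) \<le> c1 * c2 * d z" by simp
    have dw: "d w \<le> (1 + c1 * c2) * d z"
      using infdist_triangle[of "f w" "frontier (f ` ball 0 1)" "f z"] fw
      by (simp add: d_def bdry_dist_def dist_norm algebra_simps)
    have "\<exists>t. 0 \<le> t \<and> t \<le> 1 \<and> w = of_real t * \<zeta>"
    proof (cases "cmod \<zeta> = 0")
      case True
      then show ?thesis using \<phi>(3) by (auto simp: w_def)
    next
      case False
      then have "rcis (cmod z) \<phi> = of_real (cmod z / cmod \<zeta>) * rcis (cmod \<zeta>) \<phi>"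
        by (simp add: rcis_def)
      then have "w = of_real (cmod z / cmod \<zeta>) * \<zeta>"
        unfolding \<phi>(1)[symmetric] w_def .
      then show ?thesis using \<phi>(3) False by (intro exI[of _ "cmod z / cmod \<zeta>"]) (auto simp: divide_le_eq)
    qed
    then have "cmod (f w - f \<zeta>) \<le> c * d w" using radial[of \<zeta>] \<phi>(4) by (auto simp: dist_norm)
    also have "\<dots> \<le> c * ((1 + c1 * c2) * d z)" using dw c by (intro mult_left_mono) auto
    finally have "cmod (f w - f \<zeta>) \<le> c * (1 + c1 * c2) * d z" by (simp add: mult.assoc)
    moreover have "cmod (f \<zeta> - f z) \<le> cmod (f w - f \<zeta>) + cmod (f w - f z)"
      using norm_triangle_ineq4[of "f w - f z" "f w - f \<zeta>"] by simp
    ultimately show ?thesis using fw by (simp add: M_def algebra_simps)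
  qed
  have "diameter (f ` Bbox z) \<le> 2 * M * d z" if z: "z \<in> ball 0 1" for z
  proof (rule diameter_le)
    show "f ` Bbox z \<noteq> {} \<or> 0 \<le> 2 * M * d z" using M d0[of z] by simp
    fix x y assume "x \<in> f ` Bbox z" "y \<in> f ` Bbox z"
    then obtain x' y' where xy: "x = f x'" "y = f y'" "x' \<in> Bbox z" "y' \<in> Bbox z" by auto
    show "cmod (x - y) \<le> 2 * M * d z"
      using near[OF z xy(3)] near[OF z xy(4)] norm_triangle_ineq4[of "f x' - f z" "f y' - f z"] xy by simp
  qed
  then show ?thesis unfolding d_def using M by (intro exI[of _ "2 * M"]) auto
qed

text \<open>The constant \<open>A\<close> comes from comparing the area of the disks of radii \<open>\<eta> \<lambda>(W\<^sub>m)\<close>, \<open>m > n\<close>, with that of a disk of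
  radius \<open>8 M \<lambda>(W\<^sub>n)\<close> that contains them. The resulting decay rate \<open>q\<close> of \<open>\<lambda>(W\<^sub>n)\<close> determines the exponent through
  \<open>q = 2 powr (-\<delta>)\<close>, because \<open>1 - \<bar>W\<^sub>n\<bar>\<close> is proportional to \<open>2\<^sup>-\<^sup>n\<close>; \<open>A \<ge> 1\<close> is imposed to make
  \<open>q > 1/2\<close>, that is \<open>\<delta> < 1\<close>. A general point of \<open>B(z)\<close> is compared with the nearest \<open>W\<^sub>N\<close> preceding it on its radius.\<close>

lemma diameter_bound_imp_growth:
  assumes bdd: "bounded (f ` ball 0 1)" and M: "M > 0"
    and diam: "\<And>z. z \<in> ball 0 1 \<Longrightarrow> diameter (f ` Bbox z) \<le> M * bdry_dist (f ` ball 0 1) (f z)"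
  shows "\<exists>\<delta> M2. 0 < \<delta> \<and> \<delta> < 1 \<and> M2 > 0 \<and> (\<forall>z\<in>ball 0 1. \<forall>\<zeta>\<in>Bbox z.
           norm_D f \<zeta> \<le> M2 * norm_D f z * ((1 - cmod \<zeta>) / (1 - cmod z)) powr (\<delta> - 1))"
proof -
  obtain L where L: "L \<ge> 1"
    "\<And>z \<zeta>. z \<in> ball 0 1 \<Longrightarrow> \<zeta> \<in> cball z ((1 - cmod z) / 2) \<Longrightarrow> cmod (deriv h \<zeta>) \<le> L * cmod (deriv h z)"
    "\<And>r \<alpha> \<beta>. 0 \<le> r \<Longrightarrow> r < 1 \<Longrightarrow> \<bar>\<alpha> - \<beta>\<bar> \<le> pi * (1 - r) \<Longrightarrow>
              cmod (deriv h (rcis r \<alpha>)) \<le> L * cmod (deriv h (rcis r \<beta>))"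
    using harnack by blast
  obtain \<epsilon> where \<epsilon>: "\<epsilon> > 0" "\<epsilon> \<le> 1/4" "\<And>z. z \<in> ball 0 1 \<Longrightarrow>
     ball (f z) (\<epsilon> * (1 - k) / 2 * ((1 - cmod z) * cmod (deriv h z))) \<subseteq> f ` ball z (\<epsilon> * (1 - cmod z))"
    using image_contains_ball by blast
  define \<eta> where "\<eta> = \<epsilon> * (1 - k) / 2"
  have \<eta>: "\<eta> > 0" using \<epsilon> k_less_1 by (simp add: \<eta>_def)
  define A where "A = max 1 ((8 * M / \<eta>)\<^sup>2)"
  have A: "A \<ge> 1" "(8 * M / \<eta>)\<^sup>2 \<le> A" by (auto simp: A_def)
  define q where "q = sqrt (A / (1 + A))"
  have decay: "cmod (deriv h (rcis (1 - (1/2)^N * (1 - r)) \<phi>))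
      \<le> sqrt (1 + A) * (2 * q) ^ N * cmod (deriv h (rcis r \<phi>))"
    if r: "0 \<le> r" "r < 1" for r \<phi> N
  proof -
    define u where "u = (\<lambda>n::nat. (1/2)^n * (1 - r))"
    define W where "W = (\<lambda>n. rcis (1 - u n) \<phi>)"
    define lam where "lam = (\<lambda>n. u n * cmod (deriv h (W n)))"
    have u_pos: "u n > 0" for n using r by (simp add: u_def)
    have u_mono: "u m \<le> u n" if "n \<le> m" for n m
      using that r unfolding u_def by (intro mult_right_mono power_decreasing) auto
    have u_Suc: "u (Suc n) = u n / 2" for n by (simp add: u_def)
    have u_le1: "u n \<le> 1" for n
    proof -
      have "u 0 \<le> 1" using r by (simp add: u_def)
      then show ?thesis using u_mono[of 0 n] by linarith
    qed
    have cmW: "cmod (W n) = 1 - u n" for n using u_le1[of n] by (simp add: W_def)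
    have WD: "W n \<in> ball 0 1" for n using cmW[of n] u_pos[of n] by simp
    have lam0: "lam n \<ge> 0" for n using u_pos[of n] by (simp add: lam_def)
    define Bm where "Bm = (\<lambda>n. ball (W n) (\<epsilon> * u n))"
    have Bm_norm: "3/4 * u n < 1 - cmod \<zeta>" "1 - cmod \<zeta> < 5/4 * u n" if "\<zeta> \<in> Bm n" for n \<zeta>
    proof -
      have "cmod (W n - \<zeta>) < \<epsilon> * u n" using that by (simp add: Bm_def dist_norm)
      also have "\<dots> \<le> 1/4 * u n" using \<epsilon> u_pos[of n] by (intro mult_right_mono) auto
      finally have "\<bar>cmod (W n) - cmod \<zeta>\<bar> < 1/4 * u n"
        using norm_triangle_ineq3[of "W n" \<zeta>] by linarith
      then show "3/4 * u n < 1 - cmod \<zeta>" "1 - cmod \<zeta> < 5/4 * u n" unfolding cmW by linarith+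
    qed
    have Bm_D: "Bm n \<subseteq> ball 0 1" for n
    proof
      fix \<zeta> assume "\<zeta> \<in> Bm n"
      from Bm_norm(1)[OF this] u_pos[of n] show "\<zeta> \<in> ball 0 1" by simp
    qed
    have image_ball: "ball (f (W n)) (\<eta> * lam n) \<subseteq> f ` Bm n" for n
      using \<epsilon>(3)[OF WD[of n]] by (simp add: cmW \<eta>_def lam_def Bm_def)
    have disj: "disjoint_family_on (\<lambda>n. ball (f (W n)) (\<eta> * lam n)) I" for I
    proof -
      have lt: "Bm m \<inter> Bm n = {}" if "m < n" for m n
      proof -
        have le: "u n \<le> u m / 2" using u_mono[of "Suc m" n] that by (simp add: u_Suc)
        have False if "\<zeta> \<in> Bm m" "\<zeta> \<in> Bm n" for \<zeta>
          using Bm_norm(1)[OF that(1)] Bm_norm(2)[OF that(2)] le u_pos[of m] by linarith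
        then show ?thesis by blast
      qed
      have "ball (f (W m)) (\<eta> * lam m) \<inter> ball (f (W n)) (\<eta> * lam n) = {}" if "m \<noteq> n" for m n
      proof -
        have "Bm m \<inter> Bm n = {}" using lt[of m n] lt[of n m] that by (cases "m < n") auto
        then have "f ` Bm m \<inter> f ` Bm n = {}"
          unfolding inj_on_image_Int[OF inj_f Bm_D Bm_D, symmetric] by simp
        then show ?thesis using image_ball[of m] image_ball[of n] by blast
      qed
      then show ?thesis unfolding disjoint_family_on_def by blast
    qed
    (* A point of Bm m has polar angle \<phi> + Im (Ln (1 + v)), where v is its displacement from W m divided by W m. *)
    have Bm_box: "Bm m \<subseteq> Bbox (W n)" if "n < m" for n m
    proof
      fix \<zeta> assume \<zeta>: "\<zeta> \<in> Bm m"
      have um: "u m \<le> u n / 2" using u_mono[of "Suc n" m] that by (simp add: u_Suc)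
      define v where "v = \<zeta> / W m - 1"
      have Wm: "cmod (W m) \<ge> 1/2" using um u_le1[of n] by (simp add: cmW)
      then have W0: "W m \<noteq> 0" by auto
      have "cmod v = cmod (\<zeta> - W m) / cmod (W m)"
        using W0 by (simp add: v_def diff_divide_distrib flip: norm_divide)
      also have "\<dots> \<le> (\<epsilon> * u m) / (1/2)"
        using \<zeta> Wm \<epsilon>(1) u_pos[of m] by (intro frac_le) (auto simp: Bm_def dist_norm norm_minus_commute)
      also have "\<dots> \<le> u m / 2" using mult_right_mono[OF \<epsilon>(2), of "u m"] u_pos[of m] by simp
      finally have v: "cmod v \<le> u m / 2" .
      have v1: "cmod v < 1/2" using v um u_le1[of n] u_pos[of n] by linarith
      have nz: "1 + v \<noteq> 0"
      proof
        assume "1 + v = 0"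
        then have "v = -1" by (simp add: add_eq_0_iff)
        then show False using v1 by simp
      qed
      define \<psi> where "\<psi> = \<phi> + Im (Ln (1 + v))"
      define \<rho> where "\<rho> = (1 - u m) * exp (Re (Ln (1 + v)))"
      have "\<zeta> = W m * (1 + v)" using W0 by (simp add: v_def)
      also have "1 + v = exp (Ln (1 + v))" using nz by simp
      also have "exp (Ln (1 + v)) = rcis (exp (Re (Ln (1 + v)))) (Im (Ln (1 + v)))"
        by (simp only: exp_eq_polar rcis_def)
      also have "W m * \<dots> = rcis \<rho> \<psi>"
        unfolding W_def \<psi>_def \<rho>_def by (rule rcis_mult)
      finally have \<zeta>_polar: "\<zeta> = rcis \<rho> \<psi>" .
      moreover have "\<rho> \<ge> 0" using u_le1[of m] by (simp add: \<rho>_def)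
      ultimately have pol: "\<zeta> = rcis (cmod \<zeta>) \<psi>" by simp
      have "\<bar>Im (Ln (1 + v))\<bar> \<le> cmod (Ln (1 + v))" by (rule abs_Im_le_cmod)
      also have "\<dots> \<le> 2 * cmod v" by (rule norm_Ln_le[OF v1])
      also have "\<dots> \<le> 1 * u n" using v um u_pos[of n] by linarith
      also have "\<dots> \<le> pi * u n" using pi_gt3 u_pos[of n] by (intro mult_right_mono) auto
      finally have ang: "\<bar>\<psi> - \<phi>\<bar> \<le> pi * (1 - (1 - u n))" by (simp add: \<psi>_def)
      have "rcis (cmod \<zeta>) \<psi> \<in> Bbox (W n)"
        unfolding W_def
        using Bm_norm[OF \<zeta>] um u_pos[of n] u_pos[of m] u_le1[of n] ang by (intro rcis_in_Bbox) auto
      then show "\<zeta> \<in> Bbox (W n)" using pol by simp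
    qed
    (* The disks about f (W m), m > n, are disjoint and lie in f (B(W n)), whose size is controlled by (b). *)
    have tail: "(\<Sum>m=Suc n..N. (lam m)\<^sup>2) \<le> A * (lam n)\<^sup>2" if "n < N" for n N
    proof -
      have "(\<Sum>m\<in>{Suc n..N}. (\<eta> * lam m)\<^sup>2) \<le> (8 * M * lam n)\<^sup>2"
      proof (rule sum_squares_disjoint_balls_le[OF _ disj])
        fix m assume m: "m \<in> {Suc n..N}"
        show "\<eta> * lam m \<ge> 0" using \<eta> lam0[of m] by simp
        show "ball (f (W m)) (\<eta> * lam m) \<subseteq> cball (f (W n)) (8 * M * lam n)"
        proof
          fix y assume "y \<in> ball (f (W m)) (\<eta> * lam m)"
          then have "y \<in> f ` Bbox (W n)" using image_ball Bm_box[of n m] m by fastforce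
          moreover have "f (W n) \<in> f ` Bbox (W n)"
            using WD[of n] by (auto simp: Bbox_def intro!: exI[of _ 0])
          moreover have "bounded (f ` Bbox (W n))"
            by (rule bounded_subset[OF bdd]) (auto simp: Bbox_def)
          ultimately have "dist (f (W n)) y \<le> diameter (f ` Bbox (W n))"
            by (intro diameter_bounded_bound)
          also have "\<dots> \<le> M * bdry_dist (f ` ball 0 1) (f (W n))" by (rule diam[OF WD])
          also have "\<dots> \<le> M * (8 * lam n)"
            using koebe_upper[OF WD[of n]] M by (intro mult_left_mono) (auto simp: cmW lam_def)
          finally show "y \<in> cball (f (W n)) (8 * M * lam n)" by simp
        qed
      qed (use M lam0[of n] in auto)
      then have "\<eta>\<^sup>2 * (\<Sum>m=Suc n..N. (lam m)\<^sup>2) \<le> \<eta>\<^sup>2 * ((8 * M / \<eta>)\<^sup>2 * (lam n)\<^sup>2)"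
        using \<eta> by (simp add: power_mult_distrib power_divide sum_distrib_left)
      then have "(\<Sum>m=Suc n..N. (lam m)\<^sup>2) \<le> (8 * M / \<eta>)\<^sup>2 * (lam n)\<^sup>2"
        using \<eta> by (simp only: mult_le_cancel_left_pos zero_less_power)
      also have "\<dots> \<le> A * (lam n)\<^sup>2" using A by (intro mult_right_mono) auto
      finally show ?thesis .
    qed
    have "(lam N)\<^sup>2 \<le> (1 + A) * (A / (1 + A)) ^ N * (lam 0)\<^sup>2"
      using A tail by (intro geometric_decay_of_tail_sums) auto
    then have "lam N \<le> sqrt ((1 + A) * (A / (1 + A)) ^ N * (lam 0)\<^sup>2)" by (rule real_le_rsqrt)
    also have "\<dots> = sqrt (1 + A) * q ^ N * lam 0"
      using lam0[of 0] by (simp add: q_def real_sqrt_mult real_sqrt_power)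
    finally have "(1/2)^N * (1 - r) * cmod (deriv h (W N)) \<le> sqrt (1 + A) * q ^ N * ((1 - r) * cmod (deriv h (rcis r \<phi>)))"
      by (simp add: lam_def W_def u_def)
    then have "(1 - r) * ((1/2)^N * cmod (deriv h (W N))) \<le> (1 - r) * (sqrt (1 + A) * q ^ N * cmod (deriv h (rcis r \<phi>)))"
      by (simp only: mult_ac)
    then have "(1/2)^N * cmod (deriv h (W N)) \<le> sqrt (1 + A) * q ^ N * cmod (deriv h (rcis r \<phi>))"
      using r by (simp only: mult_le_cancel_left_pos diff_gt_0_iff_gt)
    then show ?thesis
      by (simp add: W_def u_def power_divide power_mult_distrib field_simps)
  qed
  define \<delta> where "\<delta> = - log 2 q"
  have q: "1/2 < q" "q < 1"
  proof -
    have "(1/2)\<^sup>2 < A / (1 + A)" "A / (1 + A) < 1\<^sup>2"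
      using A by (simp_all add: power2_eq_square field_simps)
    from real_less_rsqrt[OF this(1)] real_less_lsqrt[OF _ this(2)] A
    show "1/2 < q" "q < 1" by (simp_all add: q_def)
  qed
  have \<delta>: "0 < \<delta>" "\<delta> < 1"
  proof -
    show "0 < \<delta>" using q by (simp add: \<delta>_def)
    have "log 2 (1/2) < log 2 q" using q by simp
    then show "\<delta> < 1" by (simp add: \<delta>_def log_divide)
  qed
  have "2 powr (1 - \<delta>) = 2 * q" using q by (simp add: \<delta>_def powr_add)
  then have pow_q: "(2 * q) ^ N = ((1/2)^N) powr (\<delta> - 1)" for N
  proof -
    have "((1/2::real)^N) powr (\<delta> - 1) = ((1/2) powr (\<delta> - 1)) ^ N"
      by (simp add: powr_power powr_realpow[symmetric] powr_powr mult.commute del: powr_realpow)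
    also have "(1/2::real) powr (\<delta> - 1) = 2 powr (1 - \<delta>)"
      by (simp add: powr_divide powr_minus_divide[symmetric])
    finally show ?thesis using \<open>2 powr (1 - \<delta>) = 2 * q\<close> by simp
  qed
  define M2 where "M2 = 2 * L * L * sqrt (1 + A)"
  have M2: "M2 > 0" using L A by (simp add: M2_def)
  have "norm_D f \<zeta> \<le> M2 * norm_D f z * ((1 - cmod \<zeta>) / (1 - cmod z)) powr (\<delta> - 1)"
    if z: "z \<in> ball 0 1" and \<zeta>: "\<zeta> \<in> Bbox z" for z \<zeta>
  proof -
    obtain \<phi> where \<phi>: "\<zeta> = rcis (cmod \<zeta>) \<phi>" "\<bar>\<phi> - Arg z\<bar> \<le> pi * (1 - cmod z)"
      "cmod z \<le> cmod \<zeta>" "cmod \<zeta> < 1"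
      using Bbox_polar[OF \<zeta>] .
    define r where "r = cmod z"
    have r: "0 \<le> r" "r < 1" using z by (auto simp: r_def)
    define x where "x = (1 - cmod \<zeta>) / (1 - r)"
    have x: "0 < x" "x \<le> 1" using \<phi>(3,4) r by (auto simp: x_def r_def divide_le_eq)
    have "\<exists>n. (1/2)^Suc n < x"
    proof -
      obtain n where "(1/2)^n < x" using real_arch_pow_inv[OF x(1), of "1/2"] by auto
      moreover have "(1/2::real)^Suc n \<le> (1/2)^n" by simp
      ultimately show ?thesis by (meson le_less_trans)
    qed
    (* W is the last point of the sequence with 1 - |\<zeta>| \<le> 1 - |W|. *)
    define N where "N = (LEAST n. (1/2)^Suc n < x)"
    have N1: "(1/2)^Suc N < x"
      unfolding N_def using \<open>\<exists>n. (1/2)^Suc n < x\<close> by (rule LeastI_ex)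
    have N2: "x \<le> (1/2)^N"
    proof (cases N)
      case 0
      then show ?thesis using x by simp
    next
      case (Suc m)
      then have "\<not> (1/2)^Suc m < x" using not_less_Least[of m "\<lambda>n. (1/2)^Suc n < x"] by (simp add: N_def)
      then show ?thesis by (simp add: Suc)
    qed
    define W where "W = rcis (1 - (1/2)^N * (1 - r)) \<phi>"
    define u where "u = (1/2)^N * (1 - r)"
    have u: "0 < u" "u \<le> 1"
      using r mult_mono[of "(1/2)^N" 1 "1 - r" 1] by (auto simp: u_def power_le_one)
    have cmW: "cmod W = 1 - u" using u by (simp add: W_def u_def)
    have x_eq: "1 - cmod \<zeta> = x * (1 - r)" using r by (simp add: x_def)
    have up: "1 - cmod \<zeta> \<le> u" unfolding x_eq u_def using N2 r by (intro mult_right_mono) auto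
    have lo: "u / 2 \<le> 1 - cmod \<zeta>"
      using mult_right_mono[of "(1/2)^Suc N" x "1 - r"] N1 r unfolding x_eq u_def by simp
    have "\<zeta> - W = of_real (cmod \<zeta> - (1 - u)) * cis \<phi>"
      unfolding W_def u_def by (subst \<phi>(1)) (simp add: rcis_def algebra_simps)
    then have "cmod (\<zeta> - W) = \<bar>cmod \<zeta> - (1 - u)\<bar>" by (simp add: norm_mult del: of_real_diff)
    then have "dist W \<zeta> \<le> (1 - cmod W) / 2"
      using up lo by (simp add: dist_norm norm_minus_commute cmW)
    then have "cmod (deriv h \<zeta>) \<le> L * cmod (deriv h W)"
      using cmW u by (intro L(2)) auto
    also have "\<dots> \<le> L * (sqrt (1 + A) * (2 * q) ^ N * cmod (deriv h (rcis r \<phi>)))"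
      unfolding W_def using decay[OF r] L by (intro mult_left_mono) auto
    also have "\<dots> \<le> L * (sqrt (1 + A) * (2 * q) ^ N * (L * cmod (deriv h z)))"
    proof -
      have "cmod (deriv h (rcis r \<phi>)) \<le> L * cmod (deriv h (rcis r (Arg z)))"
        using \<phi>(2) r by (intro L(3)) (auto simp: r_def)
      then have "cmod (deriv h (rcis r \<phi>)) \<le> L * cmod (deriv h z)" by (simp add: r_def rcis_cmod_Arg)
      then show ?thesis using L A q by (intro mult_left_mono) auto
    qed
    also have "\<dots> = L * L * sqrt (1 + A) * cmod (deriv h z) * ((1/2)^N) powr (\<delta> - 1)"
      unfolding pow_q by simp
    also have "\<dots> \<le> L * L * sqrt (1 + A) * cmod (deriv h z) * x powr (\<delta> - 1)"
      using x N2 \<delta> L A by (intro mult_left_mono powr_mono2') auto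
    also have "\<dots> \<le> L * L * sqrt (1 + A) * norm_D f z * x powr (\<delta> - 1)"
      using norm_D_bounds(1)[OF z] L A by (intro mult_left_mono mult_right_mono) auto
    finally have "cmod (deriv h \<zeta>) \<le> L * L * sqrt (1 + A) * norm_D f z * x powr (\<delta> - 1)" .
    moreover have "norm_D f \<zeta> \<le> 2 * cmod (deriv h \<zeta>)" using \<phi>(4) by (intro norm_D_bounds(2)) auto
    ultimately show ?thesis unfolding M2_def x_def r_def by simp
  qed
  then show ?thesis using \<delta> M2 by blast
qed

text \<open>The growth bound makes the speed of the image of a radius at most \<open>- \<Phi>'\<close> for a constant multiple \<open>\<Phi>\<close> of
  \<open>(1 - s \<bar>z1\<bar>) powr \<delta>\<close>, so the remaining length from the parameter \<open>t\<close> on is at most \<open>\<Phi> t\<close>, which is a multiple of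
  \<open>\<lambda>(t z1)\<close>; the latter is controlled by the distance to the boundary.\<close>

lemma growth_imp_radial_John:
  assumes fr: "frontier (f ` ball 0 1) \<noteq> {}" and \<delta>: "0 < \<delta>" and M: "M > 0"
    and growth: "\<And>z \<zeta>. z \<in> ball 0 1 \<Longrightarrow> \<zeta> \<in> Bbox z \<Longrightarrow>
      norm_D f \<zeta> \<le> M * norm_D f z * ((1 - cmod \<zeta>) / (1 - cmod z)) powr (\<delta> - 1)"
  shows "radial_John_disk f"
proof -
  define d where "d = (\<lambda>z. bdry_dist (f ` ball 0 1) (f z))"
  have d0: "d z \<ge> 0" for z by (simp add: d_def bdry_dist_def infdist_nonneg)
  obtain c2 where c2: "c2 > 0" "\<And>z. z \<in> ball 0 1 \<Longrightarrow> (1 - cmod z) * cmod (deriv h z) \<le> c2 * d z"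
    unfolding d_def using koebe_lower[OF fr] by blast
  define c where "c = max 1 (2 * M * c2 / \<delta>)"
  have len: "curve_length (f \<circ> linepath 0 z1) t 1 \<le> ennreal (c * d (of_real t * z1))"
    if z1: "z1 \<in> ball 0 1" and t: "0 \<le> t" "t \<le> 1" for z1 t
  proof -
    define x where "x = cmod z1"
    have x: "0 \<le> x" "x < 1" using z1 by (auto simp: x_def)
    have sx: "s * x < 1" if "0 \<le> s" "s \<le> 1" for s
      using mult_mono[of s 1 x x] that x by auto
    define \<gamma> where "\<gamma> = (\<lambda>s::real. f (of_real s * z1))"
    have lp: "f \<circ> linepath 0 z1 = \<gamma>"
      by (auto simp: \<gamma>_def linepath_def scaleR_conv_of_real)
    have in_D: "of_real s * z1 \<in> ball 0 1" if "0 \<le> s" "s \<le> 1" for s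
      using sx[OF that] that by (simp add: norm_mult x_def)
    define N where "N = norm_D f (of_real t * z1)"
    have N0: "N \<ge> 0" by (simp add: N_def norm_D_def)
    define Q where "Q = M * N * (1 - t * x) powr (1 - \<delta>)"
    have Q0: "Q \<ge> 0" using M N0 by (simp add: Q_def)
    define \<Phi> where "\<Phi> = (\<lambda>s. Q / \<delta> * (1 - s * x) powr \<delta>)"
    have d\<gamma>: "(\<gamma> has_vector_derivative (deriv h (of_real s * z1) * z1 + cnj (deriv g (of_real s * z1) * z1))) (at s)"
      if "0 \<le> s" "s \<le> 1" for s
    proof -
      have "((\<lambda>s. of_real s * z1) has_vector_derivative z1) (at s)"
        by (auto simp: has_vector_derivative_def scaleR_conv_of_real intro!: derivative_eq_intros)
      from vector_derivative_diff_chain_within[OF this has_derivative_at_withinI[OF has_derivative_f[OF in_D[OF that]]]]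
      show ?thesis by (simp add: \<gamma>_def o_def)
    qed
    have d\<Phi>: "((\<lambda>s. - \<Phi> s) has_vector_derivative Q * (1 - s * x) powr (\<delta> - 1) * x) (at s)"
      if "0 \<le> s" "s \<le> 1" for s
    proof -
      have "((\<lambda>s. - \<Phi> s) has_real_derivative Q * (1 - s * x) powr (\<delta> - 1) * x) (at s)"
        unfolding \<Phi>_def using sx[OF that] \<delta> by (auto intro!: derivative_eq_intros simp: field_simps)
      then show ?thesis by (simp add: has_real_derivative_iff_has_vector_derivative)
    qed
    have speed: "cmod (deriv h (of_real s * z1) * z1 + cnj (deriv g (of_real s * z1) * z1))
        \<le> Q * (1 - s * x) powr (\<delta> - 1) * x" if s: "t \<le> s" "s \<le> 1" for s
    proof -
      have s0: "0 \<le> s" using s t by linarith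
      have box: "of_real s * z1 \<in> Bbox (of_real t * z1)"
      proof -
        have "rcis (s * x) (Arg z1) \<in> Bbox (rcis (t * x) (Arg z1))"
          using s t x sx[OF s0 s(2)] sx[OF t] by (intro rcis_in_Bbox) (auto intro: mult_right_mono)
        moreover have "rcis (s * x) (Arg z1) = of_real s * z1" for s
          using rcis_cmod_Arg[of z1] by (simp add: rcis_def x_def mult.assoc)
        ultimately show ?thesis by simp
      qed
      have "cmod (deriv h (of_real s * z1) * z1 + cnj (deriv g (of_real s * z1) * z1))
          \<le> cmod (deriv h (of_real s * z1)) * x + cmod (deriv g (of_real s * z1)) * x"
        unfolding x_def by (intro norm_triangle_le) (simp add: norm_mult)
      also have "\<dots> = norm_D f (of_real s * z1) * x"
        by (simp add: norm_D_eq[OF in_D[OF s0 s(2)]] distrib_right)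
      also have "\<dots> \<le> (M * N * ((1 - s * x) / (1 - t * x)) powr (\<delta> - 1)) * x"
        using growth[OF in_D[OF t] box] x s0 t
        by (intro mult_right_mono) (auto simp: N_def norm_mult x_def)
      also have "((1 - s * x) / (1 - t * x)) powr (\<delta> - 1) = (1 - t * x) powr (1 - \<delta>) * (1 - s * x) powr (\<delta> - 1)"
        using sx[OF s0 s(2)] sx[OF t] powr_minus_divide[of "1 - t * x" "\<delta> - 1"]
        by (simp add: powr_divide)
      finally show ?thesis by (simp add: Q_def mult_ac)
    qed
    have "curve_length \<gamma> t 1 \<le> ennreal (\<Phi> t - \<Phi> 1)"
    proof (rule curve_length_le[OF t(2)])
      fix a b :: real assume ab: "t \<le> a" "a \<le> b" "b \<le> 1"
      show "dist (\<gamma> a) (\<gamma> b) \<le> \<Phi> a - \<Phi> b"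
      proof (cases "a = b")
        case False
        have "cmod (\<gamma> b - \<gamma> a) \<le> - \<Phi> b - - \<Phi> a"
        proof (rule differentiable_bound_general[where \<phi> = "\<lambda>s. - \<Phi> s"
              and f' = "\<lambda>s. deriv h (of_real s * z1) * z1 + cnj (deriv g (of_real s * z1) * z1)"
              and \<phi>' = "\<lambda>s. Q * (1 - s * x) powr (\<delta> - 1) * x"])
          show "a < b" using False ab by simp
          show "continuous_on {a..b} \<gamma>"
            using ab t by (intro continuous_at_imp_continuous_on ballI has_vector_derivative_continuous[OF d\<gamma>]) auto
          show "continuous_on {a..b} (\<lambda>s. - \<Phi> s)"
            using ab t by (intro continuous_at_imp_continuous_on ballI has_vector_derivative_continuous[OF d\<Phi>]) auto
          fix s assume s: "a < s" "s < b"
          show "(\<gamma> has_vector_derivative deriv h (of_real s * z1) * z1 + cnj (deriv g (of_real s * z1) * z1)) (at s)"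
            using s ab t by (intro d\<gamma>) auto
          show "((\<lambda>s. - \<Phi> s) has_vector_derivative Q * (1 - s * x) powr (\<delta> - 1) * x) (at s)"
            using s ab t by (intro d\<Phi>) auto
          show "cmod (deriv h (of_real s * z1) * z1 + cnj (deriv g (of_real s * z1) * z1))
              \<le> Q * (1 - s * x) powr (\<delta> - 1) * x"
            using s ab by (intro speed) auto
        qed
        then show ?thesis by (simp add: dist_norm norm_minus_commute)
      qed simp
    qed
    also have "\<dots> \<le> ennreal (c * d (of_real t * z1))"
    proof (rule ennreal_leI)
      have "\<Phi> 1 \<ge> 0" using Q0 \<delta> by (simp add: \<Phi>_def)
      then have "\<Phi> t - \<Phi> 1 \<le> \<Phi> t" by simp
      also have "\<dots> = M / \<delta> * N * (1 - t * x)"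
        using sx[OF t] powr_add[of "1 - t * x" "1 - \<delta>" \<delta>] by (simp add: \<Phi>_def Q_def)
      also have "\<dots> \<le> M / \<delta> * (2 * cmod (deriv h (of_real t * z1))) * (1 - t * x)"
        unfolding N_def using norm_D_bounds(2)[OF in_D[OF t]] M \<delta> sx[OF t]
        by (intro mult_right_mono mult_left_mono) auto
      also have "\<dots> = 2 * M / \<delta> * ((1 - cmod (of_real t * z1)) * cmod (deriv h (of_real t * z1)))"
        using t by (simp add: norm_mult x_def)
      also have "\<dots> \<le> 2 * M / \<delta> * (c2 * d (of_real t * z1))"
        using c2(2)[OF in_D[OF t]] M \<delta> by (intro mult_left_mono) auto
      also have "\<dots> = (2 * M * c2 / \<delta>) * d (of_real t * z1)" by simp
      also have "\<dots> \<le> c * d (of_real t * z1)"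
        using d0 by (intro mult_right_mono) (auto simp: c_def)
      finally show "\<Phi> t - \<Phi> 1 \<le> c * d (of_real t * z1)" .
    qed
    finally show ?thesis unfolding lp .
  qed
  have "radial_c_John_disk c f"
    unfolding radial_c_John_disk_def
  proof (intro conjI ballI)
    show "1 \<le> c" by (simp add: c_def)
    fix z1 assume z1: "z1 \<in> ball (0::complex) 1"
    show "curve_length (f \<circ> linepath 0 z1) 0 1 < \<infinity>"
      using len[OF z1, of 0] by (simp add: le_less_trans ennreal_less_top)
    fix t :: real assume t: "t \<in> {0..1}"
    have "(f \<circ> linepath 0 z1) t = f (of_real t * z1)"
      by (simp add: linepath_def scaleR_conv_of_real)
    then show "curve_length (f \<circ> linepath 0 z1) t 1 \<le> ennreal (c * bdry_dist (f ` unit_disk) ((f \<circ> linepath 0 z1) t))"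
      using len[OF z1, of t] t by (simp add: d_def)
  qed
  then show ?thesis unfolding radial_John_disk_def by blast
qed

end

theorem theorem2:
  fixes K :: real and f :: "complex \<Rightarrow> complex" and \<Omega> :: "complex set"
  assumes "K \<ge> 1"
    and "f \<in> S_H0"
    and "\<Omega> = f ` unit_disk"
    and "quasiconformal K f unit_disk \<Omega>"
    and "bounded \<Omega>"
  shows "(radial_John_disk f \<longleftrightarrow>
            (\<exists>M\<^sub>1>0. \<forall>z\<in>unit_disk. diameter (f ` Bbox z) \<le> M\<^sub>1 * bdry_dist \<Omega> (f z)))
       \<and> ((\<exists>M\<^sub>1>0. \<forall>z\<in>unit_disk. diameter (f ` Bbox z) \<le> M\<^sub>1 * bdry_dist \<Omega> (f z)) \<longleftrightarrow>
            (\<exists>\<delta> M\<^sub>2. 0 < \<delta> \<and> \<delta> < 1 \<and> M\<^sub>2 > 0 \<and>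
               (\<forall>z\<in>unit_disk. \<forall>\<zeta>\<in>Bbox z.
                  norm_D f \<zeta> \<le> M\<^sub>2 * norm_D f z *
                    ((1 - cmod \<zeta>) / (1 - cmod z)) powr (\<delta> - 1))))"
proof -
  let ?b = "\<exists>M\<^sub>1>0. \<forall>z\<in>unit_disk. diameter (f ` Bbox z) \<le> M\<^sub>1 * bdry_dist \<Omega> (f z)"
  let ?c = "\<exists>\<delta> M\<^sub>2. 0 < \<delta> \<and> \<delta> < 1 \<and> M\<^sub>2 > 0 \<and>
               (\<forall>z\<in>unit_disk. \<forall>\<zeta>\<in>Bbox z.
                  norm_D f \<zeta> \<le> M\<^sub>2 * norm_D f z *
                    ((1 - cmod \<zeta>) / (1 - cmod z)) powr (\<delta> - 1))"
  obtain h g where hol: "h holomorphic_on ball 0 1" "g holomorphic_on ball 0 1"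
    and f_eq: "\<And>z. z \<in> ball 0 1 \<Longrightarrow> f z = h z + cnj (g z)"
    and h0: "deriv h 0 = 1"
    using assms(2) unfolding S_H0_def by blast
  have inj: "inj_on f (ball 0 1)" and sp: "sense_preserving_on f (ball 0 1)"
    using assms(2) unfolding S_H0_def S_H_def by blast+
  define k where "k = (K - 1) / (K + 1)"
  have k: "0 \<le> k" "k < 1" using assms(1) by (auto simp: k_def)
  have wirtinger: "norm_D f z = cmod (deriv h z) + cmod (deriv g z)"
      "det_D f z = (cmod (deriv h z))\<^sup>2 - (cmod (deriv g z))\<^sup>2" if z: "z \<in> ball 0 1" for z
    using harmonic_wirtinger_derivs[OF has_derivative_harmonic[OF open_ball hol f_eq z]]
    by (simp_all add: norm_D_def det_D_def)
  have "AE z in lebesgue. z \<in> unit_disk \<longrightarrow> (norm_D f z)\<^sup>2 \<le> K * det_D f z"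
    using assms(4) unfolding quasiconformal_def by blast
  then have AE: "AE z in lebesgue. z \<in> ball 0 1 \<longrightarrow>
       (cmod (deriv h z) + cmod (deriv g z))\<^sup>2 \<le> K * ((cmod (deriv h z))\<^sup>2 - (cmod (deriv g z))\<^sup>2)"
    by (rule eventually_mono) (simp add: wirtinger)
  have dil: "cmod (deriv g z) \<le> k * cmod (deriv h z)" if "z \<in> ball 0 1" for z
    unfolding k_def by (rule dilatation_bound_everywhere[OF hol assms(1) AE that])
  have "deriv h z \<noteq> 0" if "z \<in> ball 0 1" for z
    using deriv_nonzero_of_sense_preserving[OF hol f_eq k dil sp _ that] h0 by simp
  then interpret harmonic_qc_disk f h g k
    using hol f_eq k dil inj by unfold_locales
  have bdd: "bounded (f ` ball 0 1)" using assms(3,5) by simp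
  then have fr: "frontier (f ` ball 0 1) \<noteq> {}"
    using not_bounded_UNIV[where 'a = complex] by (auto simp: frontier_eq_empty)
  have "radial_John_disk f \<Longrightarrow> ?b"
    unfolding assms(3) radial_John_disk_def using radial_John_imp_diameter_bound[OF fr] by blast
  moreover have "?b \<Longrightarrow> ?c"
    unfolding assms(3) using diameter_bound_imp_growth[OF bdd] by blast
  moreover have "?c \<Longrightarrow> radial_John_disk f"
    using growth_imp_radial_John[OF fr] by blast
  ultimately show ?thesis by blast
qed

end
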